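(* Let $K$ be an integrable Killing tensor on the round sphere $S^3\subset V$. Then there is an isometry $U\in \mathrm{O}(V,g)$ of $S^3$ such that the Killing tensor obtained from $K$ by applying $U$ has a diagonal algebraic curvature tensor. Equivalently, there is an orthonormal basis of $V$ in which the algebraic curvature tensor $R$ of $K$ is diagonal.
   Context: Let $(V,g)$ be a $4$-dimensional Euclidean vector space and $S^3=\{x\in V: g(x,x)=1\}$ with the induced round metric, also denoted $g$; its isometry group is $\mathrm{O}(V,g)$. A Killing tensor on a Riemannian manifold is a symmetric tensor field $K_{\alpha\beta}$ with $\nabla_{(\gamma}K_{\alpha\beta)}=0$ (complete symmetrisation, $\nabla$ the Levi-Civita connection); it is also regarded as a field of symmetric endomorphisms $K^\alpha{}_\beta=g^{\alpha\gamma}K_{\gamma\beta}$. It is called integrable if around any point of some open dense set there are local coordinates whose coordinate vectors are eigenvectors of $K$. An algebraic curvature tensor on $V$ is a tensor $R_{a_1b_1a_2b_2}$ with the algebraic symmetries of a Riemannian curvature tensor: antisymmetry in $(a_1,b_1)$ and in $(a_2,b_2)$, symmetry under exchange of these pairs, and the algebraic Bianchi identity $R_{a_1b_1a_2b_2}+R_{a_1a_2b_2b_1}+R_{a_1b_2b_1a_2}=0$. Killing tensors $K$ on $S^3$ are in linear, $\mathrm{O}(V,g)$-equivariant bijection with algebraic curvature tensors $R$ on $V$ via $$K_x(v,w)=R_{a_1b_1a_2b_2}x^{a_1}x^{a_2}v^{b_1}w^{b_2},\qquad x\in S^3,\ v,w\in T_xS^3 .$$ $R$ is called the algebraic curvature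 tensor of $K$. With respect to an orthonormal basis of $V$, $R$ is diagonal if $R_{ijkl}=0$ unless $\{i,j\}=\{k,l\}$. *)

theory Defs
  imports "HOL-Analysis.Analysis"
begin

section \<open>Smooth maps\<close>

primrec C_k_on :: "nat \<Rightarrow> 'a::real_normed_vector set \<Rightarrow> ('a \<Rightarrow> 'b::real_normed_vector) \<Rightarrow> bool" where
  "C_k_on 0 S f \<longleftrightarrow> continuous_on S f"
| "C_k_on (Suc n) S f \<longleftrightarrow>
     (\<forall>x\<in>S. f differentiable (at x)) \<and>
     (\<forall>v. C_k_on n S (\<lambda>x. frechet_derivative f (at x) v))"

text \<open>Smoothness on an arbitrary subset, via local smooth extensions. For open \<open>A\<close> this is
  ordinary smoothness; for the unit sphere it is smoothness on the sphere as a submanifold.\<close>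

definition smooth_on :: "'a::real_normed_vector set \<Rightarrow> ('a \<Rightarrow> 'b::real_normed_vector) \<Rightarrow> bool" where
  "smooth_on A f \<longleftrightarrow>
     (\<forall>p\<in>A. \<exists>N F. open N \<and> p \<in> N \<and> (\<forall>n. C_k_on n N F) \<and> (\<forall>x\<in>A \<inter> N. F x = f x))"


section \<open>Calculus on the unit sphere\<close>

definition tangent_space :: "'a::euclidean_space \<Rightarrow> 'a set" where
  "tangent_space x = {v. x \<bullet> v = 0}"

definition tangent_proj :: "'a::euclidean_space \<Rightarrow> 'a \<Rightarrow> 'a" where
  "tangent_proj x v = v - (x \<bullet> v) *\<^sub>R x"

definition vector_field :: "('a::euclidean_space \<Rightarrow> 'a) \<Rightarrow> bool" where
  "vector_field X \<longleftrightarrow> smooth_on (sphere 0 1) X \<and> (\<forall>x\<in>sphere 0 1. X x \<in> tangent_space x)"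

text \<open>The derivative at \<open>x\<close> in the tangent direction \<open>u\<close> of a map given on the sphere; values off
  the sphere are irrelevant, since the map is first extended constantly along rays.\<close>

definition sphere_deriv ::
    "('a::euclidean_space \<Rightarrow> 'b::real_normed_vector) \<Rightarrow> 'a \<Rightarrow> 'a \<Rightarrow> 'b" where
  "sphere_deriv f x u = frechet_derivative (\<lambda>y. f (y /\<^sub>R norm y)) (at x) u"

text \<open>The Levi-Civita connection of the round metric: by the Gauss formula it is the tangential part
  of the derivative in the ambient Euclidean space.\<close>

definition levi_civita :: "('a::euclidean_space \<Rightarrow> 'a) \<Rightarrow> ('a \<Rightarrow> 'a) \<Rightarrow> 'a \<Rightarrow> 'a" where
  "levi_civita X Y x = tangent_proj x (sphere_deriv Y x (X x))"

text \<open>A covariant 2-tensor field is a function \<open>K\<close> of which only the values \<open>K x v w\<close> with \<open>x\<close> on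
  the sphere and \<open>v\<close>, \<open>w\<close> tangent at \<open>x\<close> are ever used.\<close>

definition symmetric_tensor_field :: "('a::euclidean_space \<Rightarrow> 'a \<Rightarrow> 'a \<Rightarrow> real) \<Rightarrow> bool" where
  "symmetric_tensor_field K \<longleftrightarrow>
     (\<forall>x\<in>sphere 0 1. \<forall>v\<in>tangent_space x. \<forall>w\<in>tangent_space x. K x v w = K x w v) \<and>
     (\<forall>x\<in>sphere 0 1. \<forall>u\<in>tangent_space x. \<forall>v\<in>tangent_space x. \<forall>w\<in>tangent_space x. \<forall>a b.
        K x (a *\<^sub>R u + b *\<^sub>R v) w = a * K x u w + b * K x v w) \<and>
     (\<forall>X Y. vector_field X \<longrightarrow> vector_field Y \<longrightarrow>
        smooth_on (sphere 0 1) (\<lambda>x. K x (X x) (Y x)))"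

text \<open>\<open>covariant_deriv K X Y Z\<close> is \<open>(\<nabla>\<^sub>X K)(Y, Z)\<close>.\<close>

definition covariant_deriv ::
    "('a::euclidean_space \<Rightarrow> 'a \<Rightarrow> 'a \<Rightarrow> real) \<Rightarrow>
     ('a \<Rightarrow> 'a) \<Rightarrow> ('a \<Rightarrow> 'a) \<Rightarrow> ('a \<Rightarrow> 'a) \<Rightarrow> 'a \<Rightarrow> real" where
  "covariant_deriv K X Y Z x =
     sphere_deriv (\<lambda>y. K y (Y y) (Z y)) x (X x)
       - K x (levi_civita X Y x) (Z x) - K x (Y x) (levi_civita X Z x)"

definition symmetrisation :: "('v \<Rightarrow> 'v \<Rightarrow> 'v \<Rightarrow> real) \<Rightarrow> 'v \<Rightarrow> 'v \<Rightarrow> 'v \<Rightarrow> real" where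
  "symmetrisation T u v w =
     (T u v w + T u w v + T v u w + T v w u + T w u v + T w v u) / 6"

definition killing_tensor :: "('a::euclidean_space \<Rightarrow> 'a \<Rightarrow> 'a \<Rightarrow> real) \<Rightarrow> bool" where
  "killing_tensor K \<longleftrightarrow>
     symmetric_tensor_field K \<and>
     (\<forall>X Y Z. vector_field X \<longrightarrow> vector_field Y \<longrightarrow> vector_field Z \<longrightarrow>
        (\<forall>x\<in>sphere 0 1.
           symmetrisation (\<lambda>X Y Z. covariant_deriv K X Y Z x) X Y Z = 0))"


section \<open>Integrability\<close>

text \<open>The endomorphism \<open>K\<^sup>\<alpha>\<^sub>\<beta>\<close> of the tangent space at \<open>x\<close>, obtained by raising an index.\<close>

definition endo :: "('a::euclidean_space \<Rightarrow> 'a \<Rightarrow> 'a \<Rightarrow> real) \<Rightarrow> 'a \<Rightarrow> 'a \<Rightarrow> 'a" where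
  "endo K x v = (THE u. u \<in> tangent_space x \<and> (\<forall>w\<in>tangent_space x. u \<bullet> w = K x v w))"

definition eigenvector :: "('a::euclidean_space \<Rightarrow> 'a \<Rightarrow> 'a \<Rightarrow> real) \<Rightarrow> 'a \<Rightarrow> 'a \<Rightarrow> bool" where
  "eigenvector K x v \<longleftrightarrow>
     v \<in> tangent_space x \<and> v \<noteq> 0 \<and> (\<exists>l::real. endo K x v = l *\<^sub>R v)"

text \<open>Local coordinates \<open>\<phi>\<close> on an open subset \<open>U\<close> of the (3-dimensional) sphere, with inverse \<open>\<psi>\<close>
  defined on the coordinate domain \<open>W\<close>.\<close>

definition local_coordinates ::
    "'a::euclidean_space set \<Rightarrow> (real^3) set \<Rightarrow> ('a \<Rightarrow> real^3) \<Rightarrow> (real^3 \<Rightarrow> 'a) \<Rightarrow> bool" where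
  "local_coordinates U W \<phi> \<psi> \<longleftrightarrow>
     openin (top_of_set (sphere 0 1)) U \<and> open W \<and> homeomorphism U W \<phi> \<psi> \<and>
     smooth_on U \<phi> \<and> smooth_on W \<psi>"

definition coordinate_vector :: "(real^3 \<Rightarrow> 'a::euclidean_space) \<Rightarrow> real^3 \<Rightarrow> 3 \<Rightarrow> 'a" where
  "coordinate_vector \<psi> y i = frechet_derivative \<psi> (at y) (axis i 1)"

definition integrable_tensor :: "('a::euclidean_space \<Rightarrow> 'a \<Rightarrow> 'a \<Rightarrow> real) \<Rightarrow> bool" where
  "integrable_tensor K \<longleftrightarrow>
     (\<exists>D. openin (top_of_set (sphere 0 1)) D \<and> sphere 0 1 \<subseteq> closure D \<and>
        (\<forall>p\<in>D. \<exists>U W \<phi> \<psi>. p \<in> U \<and> local_coordinates U W \<phi> \<psi> \<and>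
           (\<forall>y\<in>W. \<forall>i. eigenvector K (\<psi> y) (coordinate_vector \<psi> y i))))"


section \<open>Algebraic curvature tensors\<close>

definition algebraic_curvature_tensor ::
    "('a::real_vector \<Rightarrow> 'a \<Rightarrow> 'a \<Rightarrow> 'a \<Rightarrow> real) \<Rightarrow> bool" where
  "algebraic_curvature_tensor R \<longleftrightarrow>
     (\<forall>b c d. linear (\<lambda>a. R a b c d)) \<and>
     (\<forall>a c d. linear (\<lambda>b. R a b c d)) \<and>
     (\<forall>a b d. linear (\<lambda>c. R a b c d)) \<and>
     (\<forall>a b c. linear (\<lambda>d. R a b c d)) \<and>
     (\<forall>a b c d. R b a c d = - R a b c d) \<and>
     (\<forall>a b c d. R a b d c = - R a b c d) \<and>
     (\<forall>a b c d. R c d a b = R a b c d) \<and>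
     (\<forall>a b c d. R a b c d + R a c d b + R a d b c = 0)"

lemma algebraic_curvature_tensorD:
  assumes "algebraic_curvature_tensor R"
  shows "linear (\<lambda>a. R a b c d)"
    and "linear (\<lambda>b. R a b c d)"
    and "linear (\<lambda>c. R a b c d)"
    and "linear (\<lambda>d. R a b c d)"
    and "R b a c d = - R a b c d"
    and "R a b d c = - R a b c d"
    and "R c d a b = R a b c d"
    and "R a b c d + R a c d b + R a d b c = 0"
proof -
  note ac = assms[unfolded algebraic_curvature_tensor_def]
  show "linear (\<lambda>a. R a b c d)"
    by (rule ac[THEN conjunct1, THEN spec, THEN spec, THEN spec])
  show "linear (\<lambda>b. R a b c d)"
    by (rule ac[THEN conjunct2, THEN conjunct1, THEN spec, THEN spec, THEN spec])
  show "linear (\<lambda>c. R a b c d)"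
    by (rule ac[THEN conjunct2, THEN conjunct2, THEN conjunct1, THEN spec, THEN spec, THEN spec])
  show "linear (\<lambda>d. R a b c d)"
    by (rule ac[THEN conjunct2, THEN conjunct2, THEN conjunct2, THEN conjunct1, THEN spec, THEN spec, THEN spec])
  show "R b a c d = - R a b c d"
    by (rule ac[THEN conjunct2, THEN conjunct2, THEN conjunct2, THEN conjunct2, THEN conjunct1, THEN spec, THEN spec, THEN spec, THEN spec])
  show "R a b d c = - R a b c d"
    by (rule ac[THEN conjunct2, THEN conjunct2, THEN conjunct2, THEN conjunct2, THEN conjunct2, THEN conjunct1, THEN spec, THEN spec, THEN spec, THEN spec])
  show "R c d a b = R a b c d"
    by (rule ac[THEN conjunct2, THEN conjunct2, THEN conjunct2, THEN conjunct2, THEN conjunct2, THEN conjunct2, THEN conjunct1, THEN spec, THEN spec, THEN spec, THEN spec])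
  show "R a b c d + R a c d b + R a d b c = 0"
    by (rule ac[THEN conjunct2, THEN conjunct2, THEN conjunct2, THEN conjunct2, THEN conjunct2, THEN conjunct2, THEN conjunct2, THEN spec, THEN spec, THEN spec, THEN spec])
qed

definition curvature_tensor_of ::
    "('a::euclidean_space \<Rightarrow> 'a \<Rightarrow> 'a \<Rightarrow> 'a \<Rightarrow> real) \<Rightarrow> ('a \<Rightarrow> 'a \<Rightarrow> 'a \<Rightarrow> real) \<Rightarrow> bool" where
  "curvature_tensor_of R K \<longleftrightarrow>
     algebraic_curvature_tensor R \<and>
     (\<forall>x\<in>sphere 0 1. \<forall>v\<in>tangent_space x. \<forall>w\<in>tangent_space x. K x v w = R x v x w)"

text \<open>There is at most one such tensor, so it is legitimate to speak of \<^emph>\<open>the\<close> algebraic curvature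
  tensor of \<open>K\<close>.\<close>

lemma curvature_tensor_of_unique:
  assumes R: "curvature_tensor_of R K" and R': "curvature_tensor_of R' K"
  shows "R = R'"
proof -
  define T where "T a b c d = R a b c d - R' a b c d" for a b c d
  have acR: "algebraic_curvature_tensor R" and acR': "algebraic_curvature_tensor R'"
    using R R' by (simp_all add: curvature_tensor_of_def)
  note ac = algebraic_curvature_tensorD[OF acR] and ac' = algebraic_curvature_tensorD[OF acR']
  have l1: "linear (\<lambda>a. T a b c d)" for b c d
    unfolding T_def by (rule linear_compose_sub[OF ac(1) ac'(1)])
  have l2: "linear (\<lambda>b. T a b c d)" for a c d
    unfolding T_def by (rule linear_compose_sub[OF ac(2) ac'(2)])
  have l3: "linear (\<lambda>c. T a b c d)" for a b d
    unfolding T_def by (rule linear_compose_sub[OF ac(3) ac'(3)])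
  have l4: "linear (\<lambda>d. T a b c d)" for a b c
    unfolding T_def by (rule linear_compose_sub[OF ac(4) ac'(4)])
  have s12: "T b a c d = - T a b c d" for a b c d
  proof -
    have "R b a c d = - R a b c d" "R' b a c d = - R' a b c d"
      by (rule ac(5) ac'(5))+
    then show ?thesis unfolding T_def by linarith
  qed
  have s34: "T a b d c = - T a b c d" for a b c d
  proof -
    have "R a b d c = - R a b c d" "R' a b d c = - R' a b c d"
      by (rule ac(6) ac'(6))+
    then show ?thesis unfolding T_def by linarith
  qed
  have bia: "T a b c d + T a c d b + T a d b c = 0" for a b c d
  proof -
    have "R a b c d + R a c d b + R a d b c = 0" "R' a b c d + R' a c d b + R' a d b c = 0"
      by (rule ac(8) ac'(8))+
    then show ?thesis unfolding T_def by linarith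
  qed
  have tan: "T x v x w = 0" if "x \<in> sphere 0 1" "v \<in> tangent_space x" "w \<in> tangent_space x" for x v w
  proof -
    have "K x v w = R x v x w" "K x v w = R' x v x w"
      using R R' that unfolding curvature_tensor_of_def by blast+
    then show ?thesis unfolding T_def by simp
  qed
  have unit: "T x v x w = 0" if x: "x \<in> sphere 0 1" for x v w
  proof -
    have t: "tangent_proj x u \<in> tangent_space x" for u
      using x by (simp add: tangent_proj_def tangent_space_def inner_diff_right dot_square_norm)
    have z: "T x x c d = 0" "T a b x x = 0" for a b c d
      using s12[of x x c d] s34[of a b x x] by simp_all
    have "T x (tangent_proj x v) x (tangent_proj x w) = T x v x w"
      by (simp add: tangent_proj_def linear_diff[OF l2] linear_diff[OF l4]
          linear_cmul[OF l2] linear_cmul[OF l4] z)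
    then show ?thesis using tan[OF x t t] by metis
  qed
  have all: "T x v x w = 0" for x v w
  proof (cases "x = 0")
    case True
    then show ?thesis using linear_0[OF l1] by simp
  next
    case False
    define y where "y = x /\<^sub>R norm x"
    have y: "y \<in> sphere 0 1" "x = norm x *\<^sub>R y" using False by (auto simp: y_def)
    have "T (norm x *\<^sub>R y) v (norm x *\<^sub>R y) w = 0"
      by (simp add: linear_cmul[OF l1] linear_cmul[OF l3] unit[OF y(1)])
    with y(2) show ?thesis by metis
  qed
  have s13: "T c b a d = - T a b c d" for a b c d
    using all[of "a + c" b d] all[of a b d] all[of c b d]
    by (simp add: linear_add[OF l1] linear_add[OF l3])
  have "T a b c d = 0" for a b c d
  proof -
    have s23: "T u w v z = - T u v w z" for u v w z
      using s12[of w u v z] s13[of v u w z] s12[of v u w z] by linarith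
    have "T a c d b = T a b c d"
      using s34[of a c b d] s23[of a b c d] by linarith
    moreover have "T a d b c = T a b c d"
      using s23[of a b d c] s34[of a b c d] by linarith
    ultimately show ?thesis using bia[of a b c d] by simp
  qed
  then show ?thesis unfolding T_def by (intro ext) simp
qed

definition orthonormal_basis :: "'a::euclidean_space set \<Rightarrow> bool" where
  "orthonormal_basis B \<longleftrightarrow> pairwise orthogonal B \<and> (\<forall>b\<in>B. norm b = 1) \<and> span B = UNIV"

definition diagonal_wrt :: "'a set \<Rightarrow> ('a \<Rightarrow> 'a \<Rightarrow> 'a \<Rightarrow> 'a \<Rightarrow> real) \<Rightarrow> bool" where
  "diagonal_wrt B R \<longleftrightarrow>
     (\<forall>i\<in>B. \<forall>j\<in>B. \<forall>k\<in>B. \<forall>l\<in>B. {i, j} \<noteq> {k, l} \<longrightarrow> R i j k l = 0)"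

text \<open>The tensor field obtained from \<open>K\<close> by applying an isometry \<open>U\<close>, i.e. its push-forward.\<close>

definition apply_isometry ::
    "('a \<Rightarrow> 'a) \<Rightarrow> ('a \<Rightarrow> 'a \<Rightarrow> 'a \<Rightarrow> real) \<Rightarrow> ('a \<Rightarrow> 'a \<Rightarrow> 'a \<Rightarrow> real)" where
  "apply_isometry U K x v w = K (inv U x) (inv U v) (inv U w)"

end

theory Submission
  imports Defs
begin

text \<open>By the Killing equation \<open>K(c', c')\<close> is constant along each great circle \<open>c\<close>, so for orthonormal
  \<open>x, v\<close> the number \<open>K\<^sub>x(v, v)\<close> depends only on the plane spanned by \<open>x\<close> and \<open>v\<close>. Hence it extends to a
  symmetric biquadratic form, which polarises to \<open>R\<close>.

  Let \<open>A\<^sub>x\<close> be the endomorphism \<open>\<langle>A\<^sub>x u, w\<rangle> = R(x, u, x, w)\<close>. In coordinates whose coordinate vectors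
  \<open>e\<^sub>i\<close> are eigenvectors of \<open>K\<close>, differentiating \<open>K(e\<^sub>i, e\<^sub>k) = 0 = \<langle>e\<^sub>i, e\<^sub>k\<rangle>\<close> shows that the alternating
  forms \<open>R(x, A u, v, w) + R(x, A v, w, u) + R(x, A w, u, v)\<close>, for \<open>A = A\<^sub>x\<close> and for \<open>A = A\<^sub>x\<^sup>2\<close>, vanish at
  \<open>x\<close>, and by density for all \<open>x\<close>.

  Regard \<open>R\<close> as a symmetric form on bivectors, with blocks \<open>W\<^sub>+\<close>, \<open>W\<^sub>-\<close> and \<open>Z\<close> with respect to the
  splitting into self-dual and anti-self-dual ones. Varying \<open>x\<close>, the first condition amounts to
  \<open>tr W\<^sub>+\<^sup>2 = tr W\<^sub>-\<^sup>2\<close> and \<open>W\<^sub>+ Z = Z W\<^sub>-\<close>, and then the second one yields \<open>tr W\<^sub>+\<^sup>3 = tr W\<^sub>-\<^sup>3\<close>, while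
  \<open>tr W\<^sub>+ = tr W\<^sub>-\<close> is the Bianchi identity. So \<open>W\<^sub>+\<close> and \<open>W\<^sub>-\<close> have the same spectrum and are intertwined
  by \<open>Z\<close>. As \<open>SO(4)\<close> acts on the two kinds of bivectors by independent rotations, \<open>W\<^sub>+\<close>, \<open>W\<^sub>-\<close> and \<open>Z\<close>
  become diagonal in a common orthonormal frame.\<close>

section \<open>The curvature tensor of a Killing tensor\<close>

lemma C_k_on_const: "C_k_on n S (\<lambda>_. c)"
  by (induction n arbitrary: c) (simp_all add: frechet_derivative_const)

lemma C_k_on_bounded_linear:
  assumes "bounded_linear f"
  shows "C_k_on n S f"
proof (cases n)
  case 0
  then show ?thesis using assms linear_continuous_on by auto
next
  case (Suc m)
  have "frechet_derivative f (at x) = f" for x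
    using assms bounded_linear_imp_has_derivative frechet_derivative_at by metis
  then show ?thesis
    unfolding Suc using assms C_k_on_const bounded_linear_imp_differentiable by auto
qed

text \<open>For orthonormal \<open>x\<close> and \<open>n\<close> this is the infinitesimal rotation
  in their plane. It is a smooth field on the whole sphere, as \<open>killing_tensor\<close> demands
  of its arguments, and it extends the velocity of the great circle that leaves \<open>x\<close> in
  direction \<open>n\<close>.\<close>

definition rotation_field :: "'a::euclidean_space \<Rightarrow> 'a \<Rightarrow> 'a \<Rightarrow> 'a" where
  "rotation_field x n y = (x \<bullet> y) *\<^sub>R n - (n \<bullet> y) *\<^sub>R x"

lemma bounded_linear_rotation_field: "bounded_linear (rotation_field x n)"
  unfolding rotation_field_def
  by (intro bounded_linear_sub bounded_linear_scaleR_left[THEN bounded_linear_compose]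
      bounded_linear_inner_right)

lemma vector_field_rotation_field: "vector_field (rotation_field x n)"
  unfolding vector_field_def smooth_on_def
proof (intro conjI ballI)
  fix y show "rotation_field x n y \<in> tangent_space y"
    by (simp add: tangent_space_def rotation_field_def inner_diff_right inner_commute)
next
  fix p :: 'a
  show "\<exists>N F. open N \<and> p \<in> N \<and> (\<forall>k. C_k_on k N F) \<and> (\<forall>y\<in>sphere 0 1 \<inter> N. F y = rotation_field x n y)"
    using C_k_on_bounded_linear[OF bounded_linear_rotation_field] by (metis UNIV_I open_UNIV)
qed

lemma has_derivative_normalize:
  fixes x :: "'a::euclidean_space"
  assumes "x \<bullet> x = 1"
  shows "((\<lambda>y. y /\<^sub>R norm y) has_derivative tangent_proj x) (at x)"
proof -
  have "((\<lambda>y. inverse (sqrt (y \<bullet> y)) *\<^sub>R y) has_derivative tangent_proj x) (at x)"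
    unfolding tangent_proj_def using assms
    by (auto intro!: derivative_eq_intros simp: inner_commute)
  then show ?thesis by (simp add: norm_eq_sqrt_inner)
qed

text \<open>\<open>sphere_deriv\<close> carries information only where the ray extension is
  differentiable. Near \<open>x\<close> a local smooth extension \<open>F\<close> agrees with
  \<open>f\<close> at normalised points, so the ray extension is \<open>F\<close> composed with the
  normalisation.\<close>

lemma differentiable_ray_extension:
  fixes f :: "'a::euclidean_space \<Rightarrow> 'b::real_normed_vector"
  assumes f: "smooth_on (sphere 0 1) f" and x: "x \<bullet> x = 1"
  shows "(\<lambda>y. f (y /\<^sub>R norm y)) differentiable (at x)"
proof -
  have xs: "x \<in> sphere 0 1" "x \<noteq> 0" "norm x = 1" using x by (auto simp: norm_eq_1)
  then obtain N F where N: "open N" "x \<in> N" and F: "\<And>n. C_k_on n N F" "\<And>y. y \<in> sphere 0 1 \<inter> N \<Longrightarrow> F y = f y"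
    using f unfolding smooth_on_def by meson
  have "F differentiable (at x)" using F(1)[of 1] N(2) by simp
  moreover have dn: "((\<lambda>y. y /\<^sub>R norm y) has_derivative tangent_proj x) (at x)"
    by (rule has_derivative_normalize[OF x])
  ultimately have *: "((\<lambda>y. F (y /\<^sub>R norm y)) has_derivative (frechet_derivative F (at x) \<circ> tangent_proj x)) (at x)"
    using diff_chain_at[OF dn] xs(3) by (simp add: frechet_derivative_works comp_def)
  have **: "\<forall>\<^sub>F y in at x. F (y /\<^sub>R norm y) = f (y /\<^sub>R norm y)"
  proof -
    have "((\<lambda>y. y /\<^sub>R norm y) \<longlongrightarrow> x) (at x)"
      using has_derivative_continuous[OF dn] xs(3) by (simp add: continuous_at)
    then have "\<forall>\<^sub>F y in at x. y /\<^sub>R norm y \<in> N" using N topological_tendstoD by blast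
    moreover have "\<forall>\<^sub>F y in at x. y \<noteq> 0"
      using eventually_neq_at_within[of 0 x UNIV] by simp
    ultimately show ?thesis by eventually_elim (auto intro!: F(2))
  qed
  have "F (x /\<^sub>R norm x) = f (x /\<^sub>R norm x)" using F(2)[of x] xs N(2) by simp
  from has_derivative_transform_eventually[OF * ** this UNIV_I]
  show ?thesis unfolding differentiable_def by blast
qed

text \<open>The squared area of \<open>x \<and> v\<close> times the value of \<open>K\<close> on the plane of \<open>x\<close> and \<open>v\<close>, polarised in \<open>v\<close>.
  At \<open>x = 0\<close> the factor \<open>(norm x)\<^sup>2\<close> makes the junk value of \<open>K\<close> irrelevant.\<close>

definition area_form :: "('a::euclidean_space \<Rightarrow> 'a \<Rightarrow> 'a \<Rightarrow> real) \<Rightarrow> 'a \<Rightarrow> 'a \<Rightarrow> 'a \<Rightarrow> real" where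
  "area_form K x v w = (norm x)\<^sup>2 * K (x /\<^sub>R norm x) (tangent_proj (x /\<^sub>R norm x) v) (tangent_proj (x /\<^sub>R norm x) w)"

section \<open>Killing tensors along great circles\<close>

context
  fixes K :: "'a::euclidean_space \<Rightarrow> 'a \<Rightarrow> 'a \<Rightarrow> real"
  assumes killing: "killing_tensor K"
begin

lemma tensor_sym: "K x v w = K x w v" if "x \<bullet> x = 1" "x \<bullet> v = 0" "x \<bullet> w = 0"
  using killing that unfolding killing_tensor_def symmetric_tensor_field_def
  by (simp add: tangent_space_def norm_eq_1)

lemma tensor_linear: "K x (a *\<^sub>R u + b *\<^sub>R v) w = a * K x u w + b * K x v w"
  if "x \<bullet> x = 1" "x \<bullet> u = 0" "x \<bullet> v = 0" "x \<bullet> w = 0"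
  using killing that unfolding killing_tensor_def symmetric_tensor_field_def
  by (simp add: tangent_space_def norm_eq_1)

lemma tensor_scale: "K x (a *\<^sub>R v) (a *\<^sub>R v) = a\<^sup>2 * K x v v"
  if "x \<bullet> x = 1" "x \<bullet> v = 0"
  using tensor_linear[of x v v "a *\<^sub>R v" a 0] tensor_linear[of x v v v a 0]
    tensor_sym[of x v "a *\<^sub>R v"] that by (simp add: power2_eq_square)

text \<open>On the circle the ambient derivative of the rotation field \<open>X\<close> along itself
  is normal to the sphere, so its covariant derivative along itself vanishes there. The Killing
  equation for \<open>X\<close>, \<open>X\<close>, \<open>X\<close> then says that K(X, X) is
  stationary in direction \<open>X\<close>, the velocity.\<close>

lemma constant_along_great_circle:
  assumes xn: "x \<bullet> x = 1" "n \<bullet> n = 1" "x \<bullet> n = 0"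
  shows "K (cos t *\<^sub>R x + sin t *\<^sub>R n) (cos t *\<^sub>R n - sin t *\<^sub>R x) (cos t *\<^sub>R n - sin t *\<^sub>R x) = K x n n"
proof -
  define X where "X = rotation_field x n"
  define \<gamma> where "\<gamma> t = cos t *\<^sub>R x + sin t *\<^sub>R n" for t
  define \<gamma>' where "\<gamma>' t = cos t *\<^sub>R n - sin t *\<^sub>R x" for t
  define h where "h y = K y (X y) (X y)" for y
  define H where "H y = h (y /\<^sub>R norm y)" for y
  have nx: "n \<bullet> x = 0" using xn by (simp add: inner_commute)
  have \<gamma>: "\<gamma> t \<bullet> \<gamma> t = 1" for t
    using xn nx sin_cos_squared_add3[of t]
    by (simp add: \<gamma>_def inner_add_left inner_add_right add.commute)
  have X\<gamma>: "X (\<gamma> t) = \<gamma>' t" "X (\<gamma>' t) = - \<gamma> t" for t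
    using xn nx by (simp_all add: X_def rotation_field_def \<gamma>_def \<gamma>'_def inner_add_right inner_diff_right)
  have vX: "vector_field X" unfolding X_def by (rule vector_field_rotation_field)
  have smooth: "smooth_on (sphere 0 1) h"
    using killing vX unfolding killing_tensor_def symmetric_tensor_field_def h_def by blast
  have stationary: "sphere_deriv h (\<gamma> t) (\<gamma>' t) = 0" for t
  proof -
    have s: "\<gamma> t \<in> sphere 0 1" using \<gamma> by (simp add: norm_eq_1)
    have t: "\<gamma> t \<bullet> \<gamma>' t = 0"
      using xn nx by (simp add: \<gamma>_def \<gamma>'_def inner_add_left inner_diff_right)
    have "((\<lambda>y. X (y /\<^sub>R norm y)) has_derivative (X \<circ> tangent_proj (\<gamma> t))) (at (\<gamma> t))"
      using bounded_linear.has_derivative[OF bounded_linear_rotation_field has_derivative_normalize[OF \<gamma>]]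
      by (simp add: X_def comp_def)
    then have "sphere_deriv X (\<gamma> t) (X (\<gamma> t)) = - \<gamma> t"
      unfolding sphere_deriv_def using frechet_derivative_at t
      by (metis (no_types, lifting) X\<gamma> comp_apply diff_zero scale_zero_left tangent_proj_def)
    then have lc: "levi_civita X X (\<gamma> t) = 0"
      unfolding levi_civita_def by (simp add: tangent_proj_def \<gamma>)
    have 0: "K (\<gamma> t) 0 (\<gamma>' t) = 0" "K (\<gamma> t) (\<gamma>' t) 0 = 0"
      using tensor_linear[OF \<gamma>, of t 0 0 "\<gamma>' t" 0 0] tensor_sym[OF \<gamma>, of t 0 "\<gamma>' t"] t by simp_all
    have "symmetrisation (\<lambda>X Y Z. covariant_deriv K X Y Z (\<gamma> t)) X X X = 0"
      using killing vX s unfolding killing_tensor_def by blast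
    then show ?thesis
      by (simp add: symmetrisation_def covariant_deriv_def lc X\<gamma> 0 h_def[symmetric])
  qed
  \<comment> \<open>Off the sphere \<open>h\<close> is meaningless, so the chain rule is applied to
    its ray extension \<open>H\<close>, which agrees with \<open>h\<close> on the circle.\<close>
  have deriv: "((\<lambda>t. h (\<gamma> t)) has_real_derivative 0) (at t)" for t
  proof -
    have "(\<gamma> has_derivative (\<lambda>s. s *\<^sub>R \<gamma>' t)) (at t)"
      unfolding \<gamma>_def \<gamma>'_def
      by (auto intro!: derivative_eq_intros simp: algebra_simps)
    moreover have HD: "(H has_derivative frechet_derivative H (at (\<gamma> t))) (at (\<gamma> t))"
      using differentiable_ray_extension[OF smooth \<gamma>] unfolding H_def frechet_derivative_works .
    ultimately have "((H \<circ> \<gamma>) has_derivative (frechet_derivative H (at (\<gamma> t)) \<circ> (\<lambda>s. s *\<^sub>R \<gamma>' t))) (at t)"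
      by (rule diff_chain_at)
    moreover have "H \<circ> \<gamma> = (\<lambda>t. h (\<gamma> t))"
      using \<gamma> by (auto simp: H_def norm_eq_1[symmetric])
    moreover have "frechet_derivative H (at (\<gamma> t)) (s *\<^sub>R \<gamma>' t) = 0" for s
      using linear_scale[OF has_derivative_linear[OF HD]] stationary[of t]
      unfolding sphere_deriv_def H_def by simp
    ultimately show ?thesis by (simp add: has_field_derivative_def comp_def lambda_zero)
  qed
  have "h (\<gamma> t) = h (\<gamma> 0)" using DERIV_isconst_all deriv by blast
  then show ?thesis unfolding h_def X\<gamma> by (simp add: \<gamma>_def \<gamma>'_def)
qed

lemma area_form_zero: "area_form K 0 v w = 0" by (simp add: area_form_def)

lemma normalize_tangent:
  assumes "x \<noteq> 0"
  shows "(x /\<^sub>R norm x) \<bullet> (x /\<^sub>R norm x) = 1" "(x /\<^sub>R norm x) \<bullet> tangent_proj (x /\<^sub>R norm x) v = 0"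
proof -
  show *: "(x /\<^sub>R norm x) \<bullet> (x /\<^sub>R norm x) = 1"
    by (subst norm_eq_1[symmetric]) (simp add: assms)
  show "(x /\<^sub>R norm x) \<bullet> tangent_proj (x /\<^sub>R norm x) v = 0"
    unfolding tangent_proj_def inner_diff_right inner_scaleR_right[of "x /\<^sub>R norm x" _ "x /\<^sub>R norm x"] * by simp
qed

lemma area_form_sym: "area_form K x v w = area_form K x w v"
proof (cases "x = 0")
  case False
  show ?thesis
    unfolding area_form_def
    using tensor_sym[OF normalize_tangent(1)[OF False] normalize_tangent(2)[OF False] normalize_tangent(2)[OF False]]
    by (rule arg_cong)
qed (simp add: area_form_zero)

lemma area_form_linear: "linear (\<lambda>v. area_form K x v w)"
proof (cases "x = 0")
  case False
  have "tangent_proj y (a + b) = 1 *\<^sub>R tangent_proj y a + 1 *\<^sub>R tangent_proj y b"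
    "tangent_proj y (c *\<^sub>R a) = c *\<^sub>R tangent_proj y a + 0 *\<^sub>R tangent_proj y a" for y a b :: 'a and c
    by (simp_all add: tangent_proj_def inner_add_right algebra_simps)
  then show ?thesis
    by (intro linearI) (simp_all only: area_form_def tensor_linear normalize_tangent[OF False], simp_all add: algebra_simps)
qed (simp add: area_form_def linear_iff)

lemma area_form_degenerate: "area_form K x x w = 0"
proof (cases "x = 0")
  case False
  have "tangent_proj (x /\<^sub>R norm x) x = (1 - inverse (norm x) * (x \<bullet> x) * inverse (norm x)) *\<^sub>R x"
    by (simp add: tangent_proj_def algebra_simps)
  also have "inverse (norm x) * (x \<bullet> x) * inverse (norm x) = 1"
    using False by (simp add: power2_norm_eq_inner[symmetric] power2_eq_square field_simps)
  finally have "tangent_proj (x /\<^sub>R norm x) x = 0 *\<^sub>R 0 + 0 *\<^sub>R 0" by simp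
  then show ?thesis
    unfolding area_form_def using tensor_linear[of _ 0 0 "tangent_proj _ w" 0 0] normalize_tangent[OF False]
    by simp
qed (simp add: area_form_zero)

text \<open>After normalisation to unit vectors \<open>y\<close> and \<open>u\<close>, the vector
  \<open>u\<close> is the point with parameter \<open>t\<close> on the great circle leaving
  \<open>y\<close> in direction \<open>n\<close>. Both projected vectors are, up to sign and norm,
  sin t times the velocity of this circle, at \<open>y\<close> and at \<open>u\<close>, where K
  takes the same value.\<close>

lemma area_form_swap: "area_form K x v v = area_form K v x x"
proof (cases "x = 0 \<or> v = 0")
  case True
  then show ?thesis using area_form_linear[of x v, THEN linear_0] area_form_linear[of v x, THEN linear_0]
    by (auto simp: area_form_zero)
next
  case False
  define y where "y = x /\<^sub>R norm x"
  define u where "u = v /\<^sub>R norm v"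
  have x: "x = norm x *\<^sub>R y" and v: "v = norm v *\<^sub>R u" using False by (simp_all add: y_def u_def)
  have y: "y \<bullet> y = 1" and u: "u \<bullet> u = 1"
    using False normalize_tangent(1) unfolding y_def u_def by blast+
  define p where "p = y \<bullet> u"
  define m where "m = u - p *\<^sub>R y"
  have tp: "tangent_proj y v = norm v *\<^sub>R m" "tangent_proj u x = norm x *\<^sub>R (y - p *\<^sub>R u)"
    by (subst x v; simp add: tangent_proj_def m_def p_def inner_commute algebra_simps)+
  have mm: "m \<bullet> m = 1 - p\<^sup>2" "y \<bullet> m = 0"
    using u y by (simp_all add: m_def p_def inner_diff_left inner_diff_right inner_commute power2_eq_square)
  show ?thesis
  proof (cases "m = 0")
    \<comment> \<open>Here \<open>x\<close> and \<open>v\<close> are parallel, so both projections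
      vanish.\<close>
    case True
    then have "u = p *\<^sub>R y" "p\<^sup>2 = 1" using mm by (simp_all add: m_def)
    then have "y - p *\<^sub>R u = 0" by (simp add: power2_eq_square)
    moreover have "K z 0 0 = 0" if "z \<bullet> z = 1" for z using tensor_scale[OF that, of 0 0] by simp
    ultimately show ?thesis
      using tp True y u unfolding area_form_def y_def[symmetric] u_def[symmetric] by simp
  next
    case m: False
    define n where "n = m /\<^sub>R norm m"
    have n: "n \<bullet> n = 1" "y \<bullet> n = 0" "m = norm m *\<^sub>R n"
      using m mm(2) normalize_tangent(1)[OF m] by (simp_all add: n_def)
    have "p\<^sup>2 + (norm m)\<^sup>2 = 1" using mm by (simp add: power2_norm_eq_inner)
    then obtain t where t: "p = cos t" "norm m = sin t" using sincos_total_2pi by metis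
    have um: "u = cos t *\<^sub>R y + sin t *\<^sub>R n" using n(3) t by (simp add: m_def algebra_simps)
    have c: "1 - cos t * cos t = sin t * sin t" using sin_squared_eq[of t] by (simp add: power2_eq_square)
    have "y - p *\<^sub>R u = (1 - cos t * cos t) *\<^sub>R y - (cos t * sin t) *\<^sub>R n"
      by (simp add: um t(1) algebra_simps)
    also have "\<dots> = (- sin t) *\<^sub>R (cos t *\<^sub>R n - sin t *\<^sub>R y)"
      unfolding c by (simp add: algebra_simps)
    finally have tx: "tangent_proj u x = (- norm x * sin t) *\<^sub>R (cos t *\<^sub>R n - sin t *\<^sub>R y)"
      using tp(2) by simp
    have tv: "tangent_proj y v = (norm v * sin t) *\<^sub>R n" using tp(1) n(3) t(2) by (metis scaleR_scaleR)
    have ng: "u \<bullet> (cos t *\<^sub>R n - sin t *\<^sub>R y) = 0"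
      unfolding um using n y inner_commute[of n y] by (simp add: inner_add_left inner_diff_right)
    have "area_form K x v v = (norm x)\<^sup>2 * ((norm v * sin t)\<^sup>2 * K y n n)"
      unfolding area_form_def y_def[symmetric] tv tensor_scale[OF y n(2)] ..
    moreover have "area_form K v x x = (norm v)\<^sup>2 * ((- norm x * sin t)\<^sup>2 * K y n n)"
      unfolding area_form_def u_def[symmetric] tx tensor_scale[OF u ng]
      using constant_along_great_circle[OF y n(1,2), of t] um by simp
    ultimately show ?thesis by (simp add: power_mult_distrib)
  qed
qed

end

text \<open>By \<open>swap\<close> the form is quadratic in its first argument too. Polarising there
  gives \<open>S\<close>, symmetric within each pair of arguments and under exchange of the pairs;
  antisymmetrising \<open>S\<close> produces a curvature tensor.\<close>

lemma curvature_tensor_from_biquadratic: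
  fixes B :: "'a::euclidean_space \<Rightarrow> 'a \<Rightarrow> 'a \<Rightarrow> real"
  assumes lin: "\<And>x w. linear (\<lambda>v. B x v w)" and sym: "\<And>x v w. B x v w = B x w v"
    and swap: "\<And>x v. B x v v = B v x x" and deg: "\<And>x w. B x x w = 0"
  shows "\<exists>R. algebraic_curvature_tensor R \<and> (\<forall>x v w. R x v x w = B x v w)"
proof -
  define S where "S x y v w = (B (v + w) x y - B (v - w) x y) / 4" for x y v w
  have B: "B x (u + v) w = B x u w + B x v w" "B x (u - v) w = B x u w - B x v w" "B x (c *\<^sub>R u) w = c * B x u w"
    "B x w (u + v) = B x w u + B x w v" "B x w (u - v) = B x w u - B x w v" "B x w (c *\<^sub>R u) = c * B x w u" for x u v w c
    using linear_add[OF lin] linear_diff[OF lin] linear_scale[OF lin] sym[of x w] by (metis real_scaleR_def)+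
  have S1: "S (u + v) y a b = S u y a b + S v y a b" "S (u - v) y a b = S u y a b - S v y a b"
    "S (c *\<^sub>R u) y a b = c * S u y a b"
    "S y (u + v) a b = S y u a b + S y v a b" "S y (u - v) a b = S y u a b - S y v a b"
    "S y (c *\<^sub>R u) a b = c * S y u a b" for u v y a b c
    by (simp_all add: S_def B algebra_simps diff_divide_distrib add_divide_distrib)
  have S_sym: "S x y v w = S y x v w" for x y v w by (simp add: S_def sym)
  have S_diag: "S x x v w = B x v w" for x v w
    unfolding S_def swap[of "v + w" x] swap[of "v - w" x] by (simp add: B sym[of x w v])
  have S_swap: "S x y v w = S v w x y" for x y v w
  proof -
    have "S x y v w = (S (x + y) (x + y) v w - S (x - y) (x - y) v w) / 4"
      by (simp only: S1) (simp add: S_sym[of y x])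
    then show ?thesis by (simp only: S_diag) (simp add: S_def)
  qed
  have S2: "S a b (u + v) y = S a b u y + S a b v y" "S a b (c *\<^sub>R u) y = c * S a b u y"
    "S a b y (u + v) = S a b y u + S a b y v" "S a b y (c *\<^sub>R u) = c * S a b y u"
    "S a b (u - v) y = S a b u y - S a b v y" for u v y a b c
    by (simp_all add: S_swap[of a b] S1)
  \<comment> \<open>The Bianchi identity forces the factor: \<open>S(x, x; v, w) + 2 S(v, x; x, w) = 0\<close>.\<close>
  define R where "R a b c d = 2 / 3 * (S a c b d - S b c a d)" for a b c d
  have "algebraic_curvature_tensor R"
    unfolding algebraic_curvature_tensor_def
  proof (intro conjI allI)
    fix a b c d
    show "linear (\<lambda>a. R a b c d)" "linear (\<lambda>b. R a b c d)" "linear (\<lambda>c. R a b c d)" "linear (\<lambda>d. R a b c d)"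
      by (intro linearI; simp add: R_def S1 S2 algebra_simps)+
    show "R b a c d = - R a b c d" by (simp add: R_def field_simps)
    show "R a b d c = - R a b c d"
      using S_swap[of a d b c] S_swap[of b d a c] by (simp add: R_def field_simps)
    have "S d b c a = S a c b d" using S_swap[of d b c a] S_sym[of c a] S_swap[of a c d b] S_sym[of d b] S_swap[of b d a c]
      by metis
    moreover have "S d a c b = S b c a d" using S_swap[of d a c b] S_sym[of c b] S_swap[of b c d a] S_sym[of d a] S_swap[of a d b c]
      by metis
    moreover have "S c a d b = S d b c a" by (rule S_swap)
    ultimately show "R c d a b = R a b c d" by (simp add: R_def)
    have "S a c b d = S d b a c" using S_swap[of a c b d] S_sym[of b d] by metis
    moreover have "S b c a d = S a d c b" using S_swap[of b c a d] S_swap[of a d c b] S_sym[of c b] by metis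
    moreover have "S c d a b = S a b d c" using S_swap[of c d a b] S_swap[of d c a b] S_sym[of c d] by metis
    ultimately show "R a b c d + R a c d b + R a d b c = 0" by (simp add: R_def field_simps)
  qed
  moreover have "R x v x w = B x v w" for x v w
  proof -
    \<comment> \<open>The instances at x + v, x - v, v and x isolate the part of this cubic
      expression that is linear in \<open>v\<close>.\<close>
    have "S y y y w = 0" for y by (simp add: S_diag deg)
    from this[of "x + v"] this[of "x - v"] this[of v] this[of x]
    have "S x x v w + S x v x w + S v x x w = 0"
      unfolding S1 S2 by linarith
    then have "S x x v w + 2 * S v x x w = 0" using S_sym[of x v x w] by simp
    then show ?thesis using S_diag[of x v w] by (simp add: R_def)
  qed
  ultimately show ?thesis by blast
qed

lemma killing_tensor_has_curvature_tensor:
  fixes K :: "'a::euclidean_space \<Rightarrow> 'a \<Rightarrow> 'a \<Rightarrow> real"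
  assumes "killing_tensor K"
  shows "\<exists>R. curvature_tensor_of R K"
proof -
  obtain R where "algebraic_curvature_tensor R" "\<And>x v w. R x v x w = area_form K x v w"
    using curvature_tensor_from_biquadratic[OF area_form_linear[OF assms] area_form_sym[OF assms]
        area_form_swap[OF assms] area_form_degenerate[OF assms]] by blast
  moreover have "area_form K x v w = K x v w"
    if "x \<in> sphere 0 1" "v \<in> tangent_space x" "w \<in> tangent_space x" for x v w
    using that by (simp add: area_form_def tangent_proj_def tangent_space_def)
  ultimately show ?thesis unfolding curvature_tensor_of_def by metis
qed

section \<open>Algebraic integrability conditions\<close>

text \<open>The Jacobi operator of \<open>R\<close> in direction \<open>x\<close>, which is the
  \<open>A\<^sub>x\<close> of the overview. At a unit vector it restricts to the endomorphism of K
  on the tangent space.\<close>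

definition jacobi :: "('a::euclidean_space \<Rightarrow> 'a \<Rightarrow> 'a \<Rightarrow> 'a \<Rightarrow> real) \<Rightarrow> 'a \<Rightarrow> 'a \<Rightarrow> 'a" where
  "jacobi R x u = (\<Sum>b\<in>Basis. R x u x b *\<^sub>R b)"

definition cyclic_sum :: "('a \<Rightarrow> 'a \<Rightarrow> 'a \<Rightarrow> real) \<Rightarrow> ('a \<Rightarrow> 'a) \<Rightarrow> 'a \<Rightarrow> 'a \<Rightarrow> 'a \<Rightarrow> real" where
  "cyclic_sum T A u v w = T (A u) v w + T (A v) w u + T (A w) u v"

text \<open>On the hyperplane orthogonal to \<open>x\<close> these cyclic sums are alternating trilinear forms, so that they
  may be tested on one basis, which need not be orthogonal.\<close>

definition integrability_conditions :: "('a::euclidean_space \<Rightarrow> 'a \<Rightarrow> 'a \<Rightarrow> 'a \<Rightarrow> real) \<Rightarrow> 'a \<Rightarrow> bool" where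
  "integrability_conditions R x \<longleftrightarrow>
     (\<forall>u v w. cyclic_sum (R x) (jacobi R x) u v w = 0) \<and>
     (\<forall>u v w. cyclic_sum (R x) (jacobi R x \<circ> jacobi R x) u v w = 0)"

text \<open>In components, continuity and the product rule for \<open>R\<close> reduce to those of
  finite sums of products.\<close>

lemma curvature_tensor_expansion:
  fixes R :: "'a::euclidean_space \<Rightarrow> 'a \<Rightarrow> 'a \<Rightarrow> 'a \<Rightarrow> real"
  assumes "algebraic_curvature_tensor R"
  shows "R a b c d = (\<Sum>i\<in>Basis. \<Sum>j\<in>Basis. \<Sum>k\<in>Basis. \<Sum>l\<in>Basis.
     (a \<bullet> i) * ((b \<bullet> j) * ((c \<bullet> k) * ((d \<bullet> l) * R i j k l))))"
proof -
  note D = algebraic_curvature_tensorD[OF assms]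
  have e: "f a = (\<Sum>b\<in>Basis. (a \<bullet> b) * f b)" if "linear f" for f :: "'a \<Rightarrow> real" and a
  proof -
    have "f a = f (\<Sum>b\<in>Basis. (a \<bullet> b) *\<^sub>R b)" by (simp add: euclidean_representation)
    then show ?thesis by (simp add: linear_sum[OF that] linear_scale[OF that])
  qed
  show ?thesis
    by (subst e[OF D(1)], subst e[OF D(2)], subst e[OF D(3)], subst e[OF D(4)]) (simp add: sum_distrib_left)
qed

lemma continuous_on_curvature:
  fixes R :: "'a::euclidean_space \<Rightarrow> 'a \<Rightarrow> 'a \<Rightarrow> 'a \<Rightarrow> real"
  assumes "algebraic_curvature_tensor R"
    and "continuous_on S a" "continuous_on S b" "continuous_on S c" "continuous_on S d"
  shows "continuous_on S (\<lambda>x. R (a x) (b x) (c x) (d x))"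
proof (rule continuous_on_eq[OF _ curvature_tensor_expansion[OF assms(1), symmetric]])
  show "continuous_on S (\<lambda>x. \<Sum>i\<in>Basis. \<Sum>j\<in>Basis. \<Sum>k\<in>Basis. \<Sum>l\<in>Basis.
     (a x \<bullet> i) * ((b x \<bullet> j) * ((c x \<bullet> k) * ((d x \<bullet> l) * R i j k l))))"
    by (intro continuous_intros assms(2-))
qed

lemma has_derivative_curvature:
  fixes R :: "'a::euclidean_space \<Rightarrow> 'a \<Rightarrow> 'a \<Rightarrow> 'a \<Rightarrow> real"
  assumes "algebraic_curvature_tensor R"
    and d: "(a has_derivative a') (at y)" "(b has_derivative b') (at y)"
      "(c has_derivative c') (at y)" "(d has_derivative d') (at y)"
  shows "((\<lambda>y. R (a y) (b y) (c y) (d y)) has_derivative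
    (\<lambda>h. R (a' h) (b y) (c y) (d y) + R (a y) (b' h) (c y) (d y) + R (a y) (b y) (c' h) (d y)
       + R (a y) (b y) (c y) (d' h))) (at y)"
proof -
  let ?E = "\<lambda>a b c d. \<Sum>i\<in>Basis. \<Sum>j\<in>Basis. \<Sum>k\<in>Basis. \<Sum>l\<in>Basis.
     (a \<bullet> i) * ((b \<bullet> j) * ((c \<bullet> k) * ((d \<bullet> l) * R i j k l)))"
  have "((\<lambda>y. ?E (a y) (b y) (c y) (d y)) has_derivative
    (\<lambda>h. ?E (a' h) (b y) (c y) (d y) + ?E (a y) (b' h) (c y) (d y) + ?E (a y) (b y) (c' h) (d y)
       + ?E (a y) (b y) (c y) (d' h))) (at y)"
    unfolding sum.distrib[symmetric]
    by (rule has_derivative_sum)+ (auto intro!: derivative_eq_intros d simp: algebra_simps)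
  then show ?thesis unfolding curvature_tensor_expansion[OF assms(1), symmetric] .
qed

lemma inner_jacobi:
  assumes "algebraic_curvature_tensor R"
  shows "jacobi R x u \<bullet> w = R x u x w"
proof -
  have l: "linear (R x u x)" by (rule algebraic_curvature_tensorD[OF assms])
  have "R x u x w = R x u x (\<Sum>b\<in>Basis. (w \<bullet> b) *\<^sub>R b)" by (simp add: euclidean_representation)
  also have "\<dots> = (\<Sum>b\<in>Basis. (w \<bullet> b) * R x u x b)"
    by (simp add: linear_sum[OF l] linear_scale[OF l])
  finally show ?thesis by (simp add: jacobi_def inner_sum_right inner_commute[of _ w] mult.commute)
qed

section \<open>Symmetry of mixed second derivatives\<close>

lemma second_difference:
  fixes f :: "'a::real_normed_vector \<Rightarrow> real"
  assumes h: "h > 0" and N: "\<And>s t. 0 \<le> s \<Longrightarrow> s \<le> h \<Longrightarrow> 0 \<le> t \<Longrightarrow> t \<le> h \<Longrightarrow> x + s *\<^sub>R u + t *\<^sub>R v \<in> N"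
    and f: "\<And>z. z \<in> N \<Longrightarrow> (f has_derivative f' z) (at z)"
    and g: "\<And>z. z \<in> N \<Longrightarrow> ((\<lambda>z. f' z u) has_derivative g' z) (at z)"
  shows "\<exists>s t. 0 < s \<and> s < h \<and> 0 < t \<and> t < h \<and>
    f (x + h *\<^sub>R u + h *\<^sub>R v) - f (x + h *\<^sub>R u) - f (x + h *\<^sub>R v) + f x
      = h\<^sup>2 * g' (x + s *\<^sub>R u + t *\<^sub>R v) v"
proof -
  have der: "((\<lambda>s. f (a + s *\<^sub>R u)) has_real_derivative f' (a + s *\<^sub>R u) u) (at s)" if "a + s *\<^sub>R u \<in> N" for a s
  proof -
    have "((\<lambda>s. a + s *\<^sub>R u) has_derivative (\<lambda>s. s *\<^sub>R u)) (at s)" by (auto intro!: derivative_eq_intros)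
    from diff_chain_at[OF this f[OF that]]
    show ?thesis
      using linear_scale[OF has_derivative_linear[OF f[OF that]]]
      by (simp add: has_field_derivative_def comp_def mult.commute[of _ "f' _ _"])
  qed
  \<comment> \<open>The mean value theorem is used in direction \<open>u\<close> for the increment
    in direction \<open>v\<close>, and below in direction \<open>v\<close> for the derivative in
    direction \<open>u\<close>.\<close>
  have "\<exists>s>0. s < h \<and> (f (x + h *\<^sub>R v + h *\<^sub>R u) - f (x + h *\<^sub>R u)) - (f (x + h *\<^sub>R v + 0 *\<^sub>R u) - f (x + 0 *\<^sub>R u))
      = (h - 0) * (f' (x + h *\<^sub>R v + s *\<^sub>R u) u - f' (x + s *\<^sub>R u) u)"
  proof (rule MVT2[OF h, of "\<lambda>s. f (x + h *\<^sub>R v + s *\<^sub>R u) - f (x + s *\<^sub>R u)"])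
    fix s assume "0 \<le> s" "s \<le> h"
    then have "x + h *\<^sub>R v + s *\<^sub>R u \<in> N" "x + s *\<^sub>R u \<in> N"
      using N[of s h] N[of s 0] h by (simp_all add: algebra_simps)
    then show "((\<lambda>s. f (x + h *\<^sub>R v + s *\<^sub>R u) - f (x + s *\<^sub>R u)) has_real_derivative
        f' (x + h *\<^sub>R v + s *\<^sub>R u) u - f' (x + s *\<^sub>R u) u) (at s)"
      by (intro DERIV_diff der)
  qed
  then obtain s where s: "0 < s" "s < h" and
    eq: "f (x + h *\<^sub>R u + h *\<^sub>R v) - f (x + h *\<^sub>R u) - f (x + h *\<^sub>R v) + f x
      = h * (f' (x + s *\<^sub>R u + h *\<^sub>R v) u - f' (x + s *\<^sub>R u) u)"
    by (auto simp: algebra_simps)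
  have "\<exists>t>0. t < h \<and> f' (x + s *\<^sub>R u + h *\<^sub>R v) u - f' (x + s *\<^sub>R u + 0 *\<^sub>R v) u = (h - 0) * g' (x + s *\<^sub>R u + t *\<^sub>R v) v"
  proof (rule MVT2[OF h, of "\<lambda>t. f' (x + s *\<^sub>R u + t *\<^sub>R v) u"])
    fix t assume "0 \<le> t" "t \<le> h"
    then have *: "x + s *\<^sub>R u + t *\<^sub>R v \<in> N" using N[of s t] s by simp
    have "((\<lambda>t. x + s *\<^sub>R u + t *\<^sub>R v) has_derivative (\<lambda>t. t *\<^sub>R v)) (at t)" by (auto intro!: derivative_eq_intros)
    from diff_chain_at[OF this g[OF *]]
    show "((\<lambda>t. f' (x + s *\<^sub>R u + t *\<^sub>R v) u) has_real_derivative g' (x + s *\<^sub>R u + t *\<^sub>R v) v) (at t)"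
      using linear_scale[OF has_derivative_linear[OF g[OF *]]]
      by (simp add: has_field_derivative_def comp_def mult.commute[of _ "g' _ _"])
  qed
  then obtain t where "0 < t" "t < h" "f' (x + s *\<^sub>R u + h *\<^sub>R v) u - f' (x + s *\<^sub>R u) u = h * g' (x + s *\<^sub>R u + t *\<^sub>R v) v"
    by auto
  with s eq show ?thesis by (intro exI[of _ s] exI[of _ t]) (simp add: power2_eq_square)
qed

text \<open>The second difference over the parallelogram with sides h u and h v is h^2 times either
  mixed derivative, each at some interior point. If the two differed at \<open>x\<close>, continuity
  would contradict this for small h.\<close>

lemma mixed_derivatives_commute_real:
  fixes f :: "'a::real_normed_vector \<Rightarrow> real"
  assumes N: "open N" "x \<in> N"
    and f: "\<And>z. z \<in> N \<Longrightarrow> (f has_derivative f' z) (at z)"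
    and gu: "\<And>z. z \<in> N \<Longrightarrow> ((\<lambda>z. f' z u) has_derivative gu z) (at z)"
    and gv: "\<And>z. z \<in> N \<Longrightarrow> ((\<lambda>z. f' z v) has_derivative gv z) (at z)"
    and cont: "continuous_on N (\<lambda>z. gu z v)" "continuous_on N (\<lambda>z. gv z u)"
  shows "gu x v = gv x u"
proof (rule ccontr)
  assume ne: "gu x v \<noteq> gv x u"
  define e where "e = dist (gu x v) (gv x u) / 2"
  have e: "e > 0" using ne by (simp add: e_def)
  have "isCont (\<lambda>z. gu z v) x" "isCont (\<lambda>z. gv z u) x"
    using cont N by (auto simp: continuous_on_eq_continuous_at)
  then obtain d1 d2 where d: "d1 > 0" "\<And>z. dist z x < d1 \<Longrightarrow> dist (gu z v) (gu x v) < e"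
    "d2 > 0" "\<And>z. dist z x < d2 \<Longrightarrow> dist (gv z u) (gv x u) < e"
    using e unfolding continuous_at_eps_delta by metis
  obtain r where r: "r > 0" "ball x r \<subseteq> N" using N open_contains_ball by blast
  define k where "k = min r (min d1 d2)"
  \<comment> \<open>This size keeps the parallelogram within distance k / 2 of
    \<open>x\<close>.\<close>
  define h where "h = k / (2 * (norm u + norm v + 1))"
  have k: "k > 0" using r d by (simp add: k_def)
  have nn: "norm u + norm v + 1 > 0" by (simp add: add_nonneg_pos)
  have h: "h > 0" unfolding h_def using k nn by simp
  have near: "dist (x + s *\<^sub>R u + t *\<^sub>R v) x < k" if "0 \<le> s" "s \<le> h" "0 \<le> t" "t \<le> h" for s t
  proof -
    have "dist (x + s *\<^sub>R u + t *\<^sub>R v) x = norm (s *\<^sub>R u + t *\<^sub>R v)" by (simp add: dist_norm algebra_simps)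
    also have "\<dots> \<le> s * norm u + t * norm v" using norm_triangle_ineq[of "s *\<^sub>R u" "t *\<^sub>R v"] that by simp
    also have "\<dots> \<le> h * norm u + h * norm v" using that by (intro add_mono mult_right_mono) auto
    also have "\<dots> \<le> h * (norm u + norm v + 1)" using h by (simp add: algebra_simps)
    also have "\<dots> = k / 2" using nn by (simp add: h_def field_simps)
    finally show ?thesis using k by simp
  qed
  have inN: "x + s *\<^sub>R u + t *\<^sub>R v \<in> N" if "0 \<le> s" "s \<le> h" "0 \<le> t" "t \<le> h" for s t
    using near[OF that] r by (auto simp: k_def dist_commute subset_iff)
  obtain s t where st: "0 < s" "s < h" "0 < t" "t < h" and
    1: "f (x + h *\<^sub>R u + h *\<^sub>R v) - f (x + h *\<^sub>R u) - f (x + h *\<^sub>R v) + f x = h\<^sup>2 * gu (x + s *\<^sub>R u + t *\<^sub>R v) v"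
    using second_difference[where N = N and f = f, OF h inN f gu] by blast
  have inN': "x + s *\<^sub>R v + t *\<^sub>R u \<in> N" if "0 \<le> s" "s \<le> h" "0 \<le> t" "t \<le> h" for s t
    using inN[of t s] that by (simp add: algebra_simps)
  obtain s' t' where st': "0 < s'" "s' < h" "0 < t'" "t' < h" and
    2: "f (x + h *\<^sub>R v + h *\<^sub>R u) - f (x + h *\<^sub>R v) - f (x + h *\<^sub>R u) + f x = h\<^sup>2 * gv (x + s' *\<^sub>R v + t' *\<^sub>R u) u"
    using second_difference[where N = N and f = f, OF h inN' f gv] by blast
  have sw: "x + s' *\<^sub>R v + t' *\<^sub>R u = x + t' *\<^sub>R u + s' *\<^sub>R v" "x + h *\<^sub>R v + h *\<^sub>R u = x + h *\<^sub>R u + h *\<^sub>R v" by simp_all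
  have "h\<^sup>2 * gu (x + s *\<^sub>R u + t *\<^sub>R v) v = h\<^sup>2 * gv (x + t' *\<^sub>R u + s' *\<^sub>R v) u"
    using 1 2 unfolding sw by linarith
  then have "gu (x + s *\<^sub>R u + t *\<^sub>R v) v = gv (x + t' *\<^sub>R u + s' *\<^sub>R v) u" using h by simp
  moreover have "dist (gu (x + s *\<^sub>R u + t *\<^sub>R v) v) (gu x v) < e"
    using near[of s t] st by (intro d(2)) (simp add: k_def)
  moreover have "dist (gv (x + t' *\<^sub>R u + s' *\<^sub>R v) u) (gv x u) < e"
    using near[of t' s'] st' by (intro d(4)) (simp add: k_def)
  ultimately have "dist (gu x v) (gv x u) < 2 * e" by (smt (verit) dist_triangle2 dist_commute)
  then show False by (simp add: e_def)
qed

text \<open>For a parametrisation \<open>F\<close> this says that coordinate vector fields commute,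
  which is how coordinates enter the integrability conditions.\<close>

lemma C2_second_derivative_symmetric:
  fixes F :: "'a::real_normed_vector \<Rightarrow> 'b::euclidean_space"
  assumes N: "open N" "x \<in> N" and F: "C_k_on 2 N F"
  shows "frechet_derivative (\<lambda>z. frechet_derivative F (at z) u) (at x) v =
    frechet_derivative (\<lambda>z. frechet_derivative F (at z) v) (at x) u"
proof (rule vector_eq_ldot[THEN iffD1], rule allI)
  fix w :: 'b
  let ?F = "\<lambda>z. frechet_derivative F (at z)"
  let ?G = "\<lambda>u z. frechet_derivative (\<lambda>z. ?F z u) (at z)"
  note F' = F[unfolded numeral_2_eq_2, simplified]
  have 1: "((\<lambda>z. w \<bullet> F z) has_derivative (\<lambda>h. w \<bullet> ?F z h)) (at z)" if "z \<in> N" for z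
    using F' that by (intro has_derivative_inner_right) (simp add: frechet_derivative_works)
  have 2: "((\<lambda>z. w \<bullet> ?F z u) has_derivative (\<lambda>h. w \<bullet> ?G u z h)) (at z)" if "z \<in> N" for z u
    using F' that by (intro has_derivative_inner_right) (simp add: frechet_derivative_works)
  have 3: "continuous_on N (\<lambda>z. w \<bullet> ?G u z v)" for u v
    using F' by (intro continuous_intros) auto
  show "w \<bullet> ?G u x v = w \<bullet> ?G v x u"
    by (rule mixed_derivatives_commute_real[OF N 1 2 2 3 3])
qed

section \<open>Cyclic sums on a frame of eigenvectors\<close>

lemma trilinear_alternating_eq_0:
  fixes T :: "'a::real_vector \<Rightarrow> 'a \<Rightarrow> 'a \<Rightarrow> real"
  assumes lin: "\<And>v w. linear (\<lambda>u. T u v w)" and cyc: "\<And>u v w. T u v w = T v w u"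
    and alt: "\<And>u v w. T v u w = - T u v w"
    and x: "\<And>v w. T x v w = 0" and e: "T e1 e2 e3 = 0"
    and span: "span {x, e1, e2, e3} = UNIV"
  shows "T u v w = 0"
proof -
  let ?B = "{x, e1, e2, e3}"
  have d1: "T u u w = 0" for u w using alt[of u u w] by simp
  have d: "T u u w = 0" "T u w u = 0" "T w u u = 0" for u w
    using d1[of u w] cyc[of w u u] cyc[of u w u] by (simp_all only:)
  have x': "T v x w = 0" "T v w x = 0" for v w
    using x cyc[of v x w] cyc[of v w x] cyc[of w x v] by (simp_all only:)
  have e1: "T e2 e3 e1 = 0" "T e3 e1 e2 = 0"
    using e cyc[of e1 e2 e3] cyc[of e2 e3 e1] by (simp_all only:)
  have e': "T e2 e3 e1 = 0" "T e3 e1 e2 = 0" "T e2 e1 e3 = 0" "T e1 e3 e2 = 0" "T e3 e2 e1 = 0"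
    using e1 e alt[of e1 e2 e3] alt[of e3 e1 e2] alt[of e2 e3 e1] by simp_all
  have base: "T a b c = 0" if "a \<in> ?B" "b \<in> ?B" "c \<in> ?B" for a b c
    using that by (auto simp: d x x' e e')
  have step: "T u b c = 0" if "\<And>a. a \<in> ?B \<Longrightarrow> T a b c = 0" for u b c
    using linear_eq_0_on_span[OF lin, of ?B b c u] that span by simp
  have 1: "T u b c = 0" if "b \<in> ?B" "c \<in> ?B" for u b c using step base that by blast
  have 2: "T u v c = 0" if "c \<in> ?B" for u v c
  proof -
    have "T v c u = 0" by (rule step) (use 1 that cyc in metis)
    then show ?thesis using cyc[of u v c] by simp
  qed
  have "T w u v = 0" by (rule step) (use 2 cyc in metis)
  then show ?thesis using cyc[of w u v] by simp
qed

context
  fixes R :: "'a::euclidean_space \<Rightarrow> 'a \<Rightarrow> 'a \<Rightarrow> 'a \<Rightarrow> real"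
  assumes ac: "algebraic_curvature_tensor R"
begin

lemmas curvature_laws = algebraic_curvature_tensorD[OF ac]

lemma curvature_repeated: "R a a c d = 0" "R c d a a = 0"
  using curvature_laws(5)[of a a c d] curvature_laws(6)[of c d a a] by simp_all

lemma linear_jacobi: "linear (jacobi R x)"
  unfolding jacobi_def
  by (intro linearI) (simp_all add: linear_add[OF curvature_laws(2)] linear_scale[OF curvature_laws(2)] scaleR_add_left sum.distrib scaleR_sum_right)

lemma jacobi_self_adjoint: "jacobi R x u \<bullet> v = u \<bullet> jacobi R x v"
  using inner_jacobi[OF ac, of x u v] inner_jacobi[OF ac, of x v u] curvature_laws(7)[of x u x v]
  by (simp add: inner_commute)

lemma jacobi_radial: "jacobi R x x = 0"
  by (simp add: jacobi_def curvature_repeated)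

text \<open>The cyclic sum alternates because \<open>R\<close> is antisymmetric in its last pair. It
  vanishes on \<open>x\<close> since A x = 0 and the other two terms cancel: the composition of the
  Jacobi operator with \<open>A\<close> is self-adjoint.\<close>

lemma cyclic_sum_eq_0:
  assumes A: "linear A" "A x = 0" "\<And>u v. jacobi R x (A u) \<bullet> v = u \<bullet> jacobi R x (A v)"
    and e: "cyclic_sum (R x) A e1 e2 e3 = 0" and span: "span {x, e1, e2, e3} = UNIV"
  shows "cyclic_sum (R x) A u v w = 0"
proof (rule trilinear_alternating_eq_0[of "cyclic_sum (R x) A", OF _ _ _ _ e span])
  note [simp] = linear_add[OF curvature_laws(2)] linear_add[OF curvature_laws(3)] linear_add[OF curvature_laws(4)]
    linear_scale[OF curvature_laws(2)] linear_scale[OF curvature_laws(3)] linear_scale[OF curvature_laws(4)] linear_add[OF A(1)] linear_scale[OF A(1)]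
  show "linear (\<lambda>u. cyclic_sum (R x) A u v w)" for v w
    by (intro linearI) (simp_all add: cyclic_sum_def algebra_simps)
  show "cyclic_sum (R x) A u v w = cyclic_sum (R x) A v w u" for u v w
    by (simp add: cyclic_sum_def)
  show "cyclic_sum (R x) A v u w = - cyclic_sum (R x) A u v w" for u v w
    using curvature_laws(6)[of x "A u" v w] curvature_laws(6)[of x "A v" u w] curvature_laws(6)[of x "A w" u v]
    by (simp add: cyclic_sum_def)
  show "cyclic_sum (R x) A x v w = 0" for v w
  proof -
    have "R x (A v) x w = R x (A w) x v"
      using A(3)[of v w] by (simp add: inner_jacobi[OF ac, symmetric] inner_commute)
    then show ?thesis
      using curvature_laws(6)[of x "A v" x w] linear_0[OF curvature_laws(2)[of x v w]] by (simp add: cyclic_sum_def A(2))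
  qed
qed

text \<open>With r1, r2, r3 the three curvature terms, the Bianchi identity gives r1 + r2 + r3 = 0,
  and symmetry of \<open>G\<close> leaves only G 1 2 3, G 1 3 2 and G 2 3 1 in the instances of
  \<open>T\<close>. If all eigenvalues agree, so do the weights \<open>m\<close>. If exactly two
  agree, the term of the third vanishes and the other two have equal weights. If all differ, every
  term vanishes.\<close>

lemma cyclic_sum_eigenvectors:
  fixes l :: "3 \<Rightarrow> real" and e :: "3 \<Rightarrow> 'a" and G :: "3 \<Rightarrow> 3 \<Rightarrow> 3 \<Rightarrow> real"
  assumes A: "\<And>i. A (e i) = m i *\<^sub>R e i" and m: "\<And>i j. l i = l j \<Longrightarrow> m i = m j"
    and G: "\<And>i j k. G i j k = G j i k"
    and T: "\<And>i j k. l i \<noteq> l k \<Longrightarrow> R (e j) (e i) x (e k) + R x (e i) (e j) (e k) = (l i - l k) * G i j k"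
  shows "cyclic_sum (R x) A (e 1) (e 2) (e 3) = 0"
proof -
  define r1 where "r1 = R x (e 1) (e 2) (e 3)"
  define r2 where "r2 = R x (e 2) (e 3) (e 1)"
  define r3 where "r3 = R x (e 3) (e 1) (e 2)"
  have r: "r1 + r2 + r3 = 0" unfolding r1_def r2_def r3_def by (rule curvature_laws(8))
  have c: "cyclic_sum (R x) A (e 1) (e 2) (e 3) = m 1 * r1 + m 2 * r2 + m 3 * r3"
    by (simp add: cyclic_sum_def A linear_scale[OF curvature_laws(2)] r1_def r2_def r3_def)
  have n: "R x (e 3) (e 2) (e 1) = - r3" "R x (e 2) (e 1) (e 3) = - r2" "R x (e 1) (e 3) (e 2) = - r1"
    unfolding r1_def r2_def r3_def by (rule curvature_laws(6))+
  have T': "R x (e k) (e j) (e i) + R x (e i) (e j) (e k) = (l i - l k) * G i j k" if "l i \<noteq> l k" for i j k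
    using T[OF that] curvature_laws(7)[of x "e k" "e j" "e i"] by simp
  note T'' = T'[of 2 3 1] T'[of 1 3 2] T'[of 3 1 2] T'[of 2 1 3] T'[of 1 2 3] T'[of 3 2 1]
  have t: "l 2 \<noteq> l 3 \<Longrightarrow> r3 - r2 = (l 2 - l 3) * G 1 2 3"
      "l 1 \<noteq> l 3 \<Longrightarrow> r1 - r3 = (l 1 - l 3) * G 1 2 3"
      "l 3 \<noteq> l 1 \<Longrightarrow> r1 - r3 = (l 3 - l 1) * G 2 3 1"
      "l 2 \<noteq> l 1 \<Longrightarrow> r2 - r1 = (l 2 - l 1) * G 2 3 1"
      "l 1 \<noteq> l 2 \<Longrightarrow> r2 - r1 = (l 1 - l 2) * G 1 3 2"
      "l 3 \<noteq> l 2 \<Longrightarrow> r3 - r2 = (l 3 - l 2) * G 1 3 2"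
    using T'' unfolding n G[of 2 1 3] G[of 3 2 1] G[of 3 1 2]
    unfolding r1_def[symmetric] r2_def[symmetric] r3_def[symmetric] by linarith+
  consider "l 1 = l 2" "l 2 = l 3" | "l 1 = l 2" "l 2 \<noteq> l 3" | "l 1 = l 3" "l 2 \<noteq> l 3" | "l 2 = l 3" "l 1 \<noteq> l 2"
    | "l 1 \<noteq> l 2" "l 2 \<noteq> l 3" "l 1 \<noteq> l 3" by metis
  then have "m 1 * r1 + m 2 * r2 + m 3 * r3 = 0"
  proof cases
    case 1
    then have "m 1 = m 3" "m 2 = m 3" using m by metis+
    then show ?thesis using r by (metis distrib_left mult_zero_right)
  next
    case 2
    then have "r3 = 0" using t(1,2) r by auto
    then show ?thesis using m[OF 2(1)] r by (metis add.right_neutral distrib_left mult_zero_right)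
  next
    case 3
    then have "r2 = 0" using t(5,6) r by auto
    then show ?thesis using m[OF 3(1)] r by (metis add.right_neutral distrib_left mult_zero_right)
  next
    case 4
    then have "r1 = 0" using t(3,4) r by auto
    then show ?thesis using m[OF 4(1)] r by (metis add.left_neutral distrib_left mult_zero_right)
  next
    case 5
    \<comment> \<open>Each difference of two of the r's occurs twice in \<open>t\<close>, with
      different entries of \<open>G\<close>; comparing both expressions forces \<open>G\<close> to
      vanish.\<close>
    have "(l 2 - l 3) * (G 1 2 3 + G 1 3 2) = 0" "(l 1 - l 3) * (G 1 2 3 + G 2 3 1) = 0"
      "(l 1 - l 2) * (G 1 3 2 + G 2 3 1) = 0"
      using t 5 by (simp_all add: algebra_simps)
    then have "G 1 2 3 + G 1 3 2 = 0" "G 1 2 3 + G 2 3 1 = 0" "G 1 3 2 + G 2 3 1 = 0" using 5 by simp_all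
    then have "G 1 2 3 = 0" "G 1 3 2 = 0" by linarith+
    then have "r1 = r3" "r2 = r1" using t 5 by simp_all
    then show ?thesis using r by simp
  qed
  then show ?thesis using c by simp
qed

text \<open>Where the two continuous eigenvalue functions stay distinct, E i and E k are orthogonal
  and R(F, E i, F, E k) is identically 0. Both vanishing functions are differentiated, and the
  eigenvector equation evaluates the terms in which E i or E k is differentiated.\<close>

lemma eigenframe_derivative_identity:
  fixes F :: "real^3 \<Rightarrow> 'a" and E :: "3 \<Rightarrow> real^3 \<Rightarrow> 'a" and l :: "3 \<Rightarrow> real^3 \<Rightarrow> real"
  assumes V: "open V" "y \<in> V"
    and F: "(F has_derivative F') (at y)" and E: "\<And>i. (E i has_derivative E' i) (at y)"
    and l: "\<And>i. continuous_on V (l i)"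
    and eig: "\<And>z i w. z \<in> V \<Longrightarrow> R (F z) (E i z) (F z) w = l i z * (E i z \<bullet> w)"
    and ne: "l i y \<noteq> l k y"
  shows "R (F' h) (E i y) (F y) (E k y) + R (F y) (E i y) (F' h) (E k y) = (l i y - l k y) * (E' i h \<bullet> E k y)"
proof -
  define V' where "V' = {z \<in> V. l i z - l k z \<noteq> 0}"
  have "open V'"
    unfolding V'_def using continuous_open_preimage[OF continuous_on_diff[OF l l] V(1), of "- {0}" i k]
    by (simp add: vimage_def Int_def open_Compl)
  moreover have "y \<in> V'" using V ne by (simp add: V'_def)
  ultimately have ev: "\<forall>\<^sub>F z in nhds y. z \<in> V'" by (rule eventually_nhds_in_open)
  have sym: "R a b c d = R c d a b" for a b c d by (rule curvature_laws(7)[symmetric])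
  have orth: "E i z \<bullet> E k z = 0" if "z \<in> V'" for z
  proof -
    have "l i z * (E i z \<bullet> E k z) = l k z * (E i z \<bullet> E k z)"
      using eig[of z i "E k z"] eig[of z k "E i z"] sym[of "F z" "E i z" "F z" "E k z"] that
      by (simp add: V'_def inner_commute)
    then show ?thesis using that by (simp add: V'_def)
  qed
  have curv: "R (F z) (E i z) (F z) (E k z) = 0" if "z \<in> V'" for z
    using eig[of z i "E k z"] orth[OF that] that by (simp add: V'_def)
  have zero: "f' h = 0" if "(f has_derivative f') (at y)" "\<And>z. z \<in> V' \<Longrightarrow> f z = 0" for f :: "real^3 \<Rightarrow> real" and f'
  proof -
    have "((\<lambda>_. 0) has_derivative f') (at y)"
      using that(1) by (rule has_derivative_transform_within_open[OF _ \<open>open V'\<close> \<open>y \<in> V'\<close>]) (rule that(2))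
    moreover have "((\<lambda>_. 0) has_derivative (\<lambda>_. 0)) (at y)" by (rule has_derivative_const)
    ultimately show ?thesis using has_derivative_unique by metis
  qed
  have "R (F' h) (E i y) (F y) (E k y) + R (F y) (E' i h) (F y) (E k y) + R (F y) (E i y) (F' h) (E k y)
       + R (F y) (E i y) (F y) (E' k h) = 0"
    by (rule zero[OF has_derivative_curvature[OF ac F E F E] curv])
  moreover have "E i y \<bullet> E' k h + E' i h \<bullet> E k y = 0"
    by (rule zero[OF has_derivative_inner[OF E E] orth])
  moreover have "R (F y) (E' i h) (F y) (E k y) = l k y * (E' i h \<bullet> E k y)"
    using eig[OF V(2), of k "E' i h"] sym[of "F y" "E' i h" "F y" "E k y"] by (simp add: inner_commute)
  moreover have "R (F y) (E i y) (F y) (E' k h) = l i y * (E i y \<bullet> E' k h)" by (rule eig[OF V(2)])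
  moreover have "E i y \<bullet> E' k h = - (E' i h \<bullet> E k y)" using calculation(2) by linarith
  ultimately show ?thesis by (simp add: algebra_simps)
qed

end

section \<open>From integrable coordinates to the conditions on the sphere\<close>

lemma C_k_on_subset: "C_k_on n S f \<Longrightarrow> T \<subseteq> S \<Longrightarrow> C_k_on n T f"
  by (induction n arbitrary: f) (auto intro: continuous_on_subset)

text \<open>The description in \<open>endo\<close> is resolved by the Jacobi operator: its value is
  tangent and represents K(v, .), and such a vector is unique.\<close>

lemma eigenvector_jacobi:
  assumes R: "curvature_tensor_of R K" and x: "x \<in> sphere 0 1" and v: "eigenvector K x v"
  obtains l where "jacobi R x v = l *\<^sub>R v"
proof -
  have K: "K x v w = R x v x w" if "w \<in> tangent_space x" for w
    using R x v that unfolding curvature_tensor_of_def eigenvector_def by blast+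
  have ac: "algebraic_curvature_tensor R" using R unfolding curvature_tensor_of_def by blast
  have j: "jacobi R x v \<in> tangent_space x"
    using inner_jacobi[OF ac, of x v x] curvature_repeated[OF ac] by (simp add: tangent_space_def inner_commute)
  have "endo K x v = jacobi R x v"
    unfolding endo_def
  proof (rule the_equality)
    show "jacobi R x v \<in> tangent_space x \<and> (\<forall>w\<in>tangent_space x. jacobi R x v \<bullet> w = K x v w)"
      using j K by (simp add: inner_jacobi[OF ac])
    fix u assume u: "u \<in> tangent_space x \<and> (\<forall>w\<in>tangent_space x. u \<bullet> w = K x v w)"
    let ?d = "u - jacobi R x v"
    have "?d \<in> tangent_space x" using u j by (simp add: tangent_space_def inner_diff_right)
    then have "?d \<bullet> ?d = 0" using u K by (simp add: inner_diff_left[of u] inner_jacobi[OF ac])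
    then show "u = jacobi R x v" by simp
  qed
  then show ?thesis using v that unfolding eigenvector_def by auto
qed

lemma span_normal_and_tangent_basis:
  fixes x :: "'a::euclidean_space" and L :: "real^3 \<Rightarrow> 'a"
  assumes dim: "DIM('a) = 4" and x: "x \<bullet> x = 1" and L: "linear L" "inj L"
    and t: "\<And>i. x \<bullet> L (axis i 1) = 0"
  shows "span {x, L (axis 1 1), L (axis 2 1), L (axis 3 1)} = UNIV"
proof -
  let ?E = "{L (axis 1 1), L (axis 2 1), L (axis 3 1)}"
  let ?A = "{axis 1 1, axis 2 1, axis 3 1} :: (real^3) set"
  have A: "?A = Basis" by (auto simp: Basis_vec_def UNIV_3)
  have cA: "card ?A = 3" unfolding A by simp
  have E: "?E = L ` ?A" by simp
  have ind: "independent ?E"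
    unfolding E by (rule linear_independent_injective_image[OF L(1)]) (use A independent_Basis L(2) in \<open>auto simp: inj_on_def inj_def\<close>)
  have "?E \<subseteq> {v. x \<bullet> v = 0}" using t by auto
  then have "span ?E \<subseteq> {v. x \<bullet> v = 0}" by (rule span_minimal) (rule subspace_hyperplane)
  then have nx: "x \<notin> span ?E" using x by auto
  then have "independent (insert x ?E)" using ind by (simp add: independent_insert)
  moreover have "card ?E = 3" unfolding E using cA L(2) card_image inj_on_subset by (metis subset_UNIV)
  moreover have "x \<notin> ?E" using nx span_superset[of ?E] by blast
  ultimately have "independent (insert x ?E)" "card (insert x ?E) = 4" by simp_all
  then have "UNIV \<subseteq> span (insert x ?E)"
    using card_ge_dim_independent[of "insert x ?E" UNIV] dim by (simp only: dim_UNIV) blast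
  then show ?thesis by blast
qed

text \<open>With \<open>F\<close> and \<open>H\<close> local smooth extensions of the
  parametrisation and the chart, \<open>H\<close> after \<open>F\<close> is the identity near
  \<open>y\<close>. The chain rule then makes the derivative of \<open>F\<close> injective, so the
  coordinate vectors at \<open>y\<close> are linearly independent.\<close>

lemma local_coordinates_frame:
  fixes \<psi> :: "real^3 \<Rightarrow> 'a::euclidean_space"
  assumes lc: "local_coordinates U W \<phi> \<psi>" and p: "p \<in> U"
  obtains V F y where "open V" "V \<subseteq> W" "y \<in> V" "F y = p" "\<And>z. z \<in> V \<Longrightarrow> F z = \<psi> z" "C_k_on 2 V F"
    "\<And>z i. z \<in> V \<Longrightarrow> coordinate_vector \<psi> z i = frechet_derivative F (at z) (axis i 1)"
    "linear (frechet_derivative F (at y))" "inj (frechet_derivative F (at y))"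
proof -
  have U: "openin (top_of_set (sphere 0 1)) U" and W: "open W" and hom: "homeomorphism U W \<phi> \<psi>"
    and s\<phi>: "smooth_on U \<phi>" and s\<psi>: "smooth_on W \<psi>"
    using lc unfolding local_coordinates_def by blast+
  define y where "y = \<phi> p"
  have y: "y \<in> W" "\<psi> y = p" using hom p unfolding y_def homeomorphism_def by auto
  obtain N F where N: "open N" "y \<in> N" and F: "\<forall>n. C_k_on n N F" "\<forall>z\<in>W \<inter> N. F z = \<psi> z"
    using s\<psi> y(1) unfolding smooth_on_def by blast
  define V where "V = W \<inter> N"
  have V: "open V" "V \<subseteq> W" "y \<in> V" using W N y by (auto simp: V_def)
  have eq: "F z = \<psi> z" if "z \<in> V" for z using F(2) that by (simp add: V_def)
  have C2: "C_k_on 2 V F" using F(1) C_k_on_subset V_def by (metis inf_le2)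
  have der: "(F has_derivative frechet_derivative F (at z)) (at z)" if "z \<in> V" for z
    using C2 that by (simp add: numeral_2_eq_2 frechet_derivative_works)
  have cv: "coordinate_vector \<psi> z i = frechet_derivative F (at z) (axis i 1)" if "z \<in> V" for z i
  proof -
    have "(\<psi> has_derivative frechet_derivative F (at z)) (at z)"
      by (rule has_derivative_transform_within_open[OF der[OF that] V(1) that eq])
    then show ?thesis unfolding coordinate_vector_def using frechet_derivative_at by metis
  qed
  obtain M H where M: "open M" "p \<in> M" and H: "\<forall>n. C_k_on n M H" "\<forall>x\<in>U \<inter> M. H x = \<phi> x"
    using s\<phi> p unfolding smooth_on_def by blast
  have dH: "(H has_derivative frechet_derivative H (at p)) (at p)"
    using H(1)[rule_format, of 1] M(2) by (simp add: frechet_derivative_works)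
  define V' where "V' = V \<inter> F -` M"
  have "continuous_on V F" using C2 der by (meson continuous_at_imp_continuous_on has_derivative_continuous)
  then have V': "open V'" "y \<in> V'"
    unfolding V'_def using V M y eq by (auto intro: continuous_open_preimage simp: Int_commute)
  have id: "(H \<circ> F) z = z" if "z \<in> V'" for z
  proof -
    have "\<psi> z \<in> U" "\<phi> (\<psi> z) = z" using hom that V(2) unfolding homeomorphism_def V'_def by auto
    then show ?thesis using H(2) eq[of z] that by (simp add: V'_def)
  qed
  have "F y = p" using eq V(3) y by simp
  then have "((H \<circ> F) has_derivative (frechet_derivative H (at p) \<circ> frechet_derivative F (at y))) (at y)"
    using diff_chain_at[OF der[OF V(3)]] dH by simp
  then have "((\<lambda>z. z) has_derivative (frechet_derivative H (at p) \<circ> frechet_derivative F (at y))) (at y)"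
    by (rule has_derivative_transform_within_open[OF _ V' id])
  then have "frechet_derivative H (at p) \<circ> frechet_derivative F (at y) = (\<lambda>z. z)"
    using has_derivative_unique has_derivative_ident by blast
  then have "inj (frechet_derivative F (at y))" by (metis inj_on_imageI2 inj_on_id2)
  then show ?thesis
    using that[of V y F] V \<open>F y = p\<close> eq C2 cv has_derivative_linear[OF der[OF V(3)]] by blast
qed

lemma integrable_imp_conditions_on_coordinate_patch:
  fixes K :: "'a::euclidean_space \<Rightarrow> 'a \<Rightarrow> 'a \<Rightarrow> real"
  assumes dim: "DIM('a) = 4" and R: "curvature_tensor_of R K"
    and lc: "local_coordinates U W \<phi> \<psi>" and p: "p \<in> U"
    and eig: "\<forall>y\<in>W. \<forall>i. eigenvector K (\<psi> y) (coordinate_vector \<psi> y i)"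
  shows "integrability_conditions R p"
proof -
  have ac: "algebraic_curvature_tensor R" using R unfolding curvature_tensor_of_def by blast
  obtain V F y where V: "open V" "V \<subseteq> W" "y \<in> V" and Fp: "F y = p" and F: "\<And>z. z \<in> V \<Longrightarrow> F z = \<psi> z"
    and C2: "C_k_on 2 V F"
    and cv: "\<And>z i. z \<in> V \<Longrightarrow> coordinate_vector \<psi> z i = frechet_derivative F (at z) (axis i 1)"
    and L: "linear (frechet_derivative F (at y))" "inj (frechet_derivative F (at y))"
    by (rule local_coordinates_frame[OF lc p]) (rule that, assumption+)
  define E where "E i z = frechet_derivative F (at z) (axis i 1)" for i z
  \<comment> \<open>As a Rayleigh quotient the eigenvalue is given by a formula from which its
    continuity follows.\<close>
  define l where "l i z = (R (F z) (E i z) (F z) (E i z)) / (E i z \<bullet> E i z)" for i z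
  have sph: "F z \<in> sphere 0 1" if "z \<in> V" for z
    using lc V(2) that F unfolding local_coordinates_def homeomorphism_def
    by (metis image_eqI openin_imp_subset subsetD)
  have ev: "eigenvector K (F z) (E i z)" if "z \<in> V" for z i
    using eig V(2) that F cv unfolding E_def by (metis subsetD)
  have tan: "F z \<bullet> E i z = 0" "E i z \<noteq> 0" if "z \<in> V" for z i
    using ev[OF that] unfolding eigenvector_def tangent_space_def by auto
  have jac: "jacobi R (F z) (E i z) = l i z *\<^sub>R E i z" if z: "z \<in> V" for z i
  proof -
    obtain m where m: "jacobi R (F z) (E i z) = m *\<^sub>R E i z"
      using eigenvector_jacobi[OF R sph[OF z] ev[OF z]] by blast
    then have "R (F z) (E i z) (F z) (E i z) = m * (E i z \<bullet> E i z)"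
      by (simp add: inner_jacobi[OF ac, symmetric])
    then have "m = l i z" using tan(2)[OF z] by (simp add: l_def)
    then show ?thesis using m by simp
  qed
  have dF: "(F has_derivative frechet_derivative F (at z)) (at z)"
    and dE: "(E i has_derivative frechet_derivative (E i) (at z)) (at z)" if "z \<in> V" for z i
    using C2 that unfolding E_def[abs_def] by (simp_all add: numeral_2_eq_2 frechet_derivative_works)
  have cF: "continuous_on V F" and cE: "continuous_on V (E i)" for i
    using dF dE by (meson continuous_at_imp_continuous_on has_derivative_continuous)+
  have cl: "continuous_on V (l i)" for i
    unfolding l_def[abs_def]
    by (intro continuous_on_divide continuous_on_curvature[OF ac] continuous_intros cF cE) (simp add: tan)
  \<comment> \<open>This pairs the mixed second derivative of \<open>F\<close> in directions i and j
    with E k, hence the symmetry in i and j. As the derivative of \<open>F\<close> in direction j is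
    E j, \<open>eigenframe_derivative_identity\<close> becomes \<open>T\<close> below.\<close>
  define G where "G i j k = frechet_derivative (E i) (at y) (axis j 1) \<bullet> E k y" for i j k
  have G: "G i j k = G j i k" for i j k
    unfolding G_def E_def[abs_def] using C2_second_derivative_symmetric[OF V(1,3) C2] by metis
  have eig': "R (F z) (E i z) (F z) w = l i z * (E i z \<bullet> w)" if "z \<in> V" for z i w
    using inner_jacobi[OF ac, of "F z" "E i z" w] jac[OF that] by simp
  have T: "R (E j y) (E i y) p (E k y) + R p (E i y) (E j y) (E k y) = (l i y - l k y) * G i j k"
    if "l i y \<noteq> l k y" for i j k
    using eigenframe_derivative_identity[where E = E and l = l and h = "axis j 1",
        OF ac V(1,3) dF[OF V(3)] dE[OF V(3)] cl eig' that]
    by (simp add: G_def E_def Fp)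
  have span: "span {p, E 1 y, E 2 y, E 3 y} = UNIV"
    unfolding E_def
    using span_normal_and_tangent_basis[OF dim _ L, of p] tan(1)[OF V(3)] sph[OF V(3)]
    by (simp add: Fp E_def norm_eq_1)
  have A: "jacobi R p (E i y) = l i y *\<^sub>R E i y" for i using jac[OF V(3)] Fp by simp
  have e1: "cyclic_sum (R p) (jacobi R p) (E 1 y) (E 2 y) (E 3 y) = 0"
    by (rule cyclic_sum_eigenvectors[OF ac, where l = "\<lambda>i. l i y" and m = "\<lambda>i. l i y" and e = "\<lambda>i. E i y", OF A _ G T])
  have 1: "cyclic_sum (R p) (jacobi R p) u v w = 0" for u v w
    by (rule cyclic_sum_eq_0[OF ac linear_jacobi[OF ac] jacobi_radial[OF ac] _ e1 span])
      (simp add: jacobi_self_adjoint[OF ac])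
  have "(jacobi R p \<circ> jacobi R p) (E i y) = (l i y)\<^sup>2 *\<^sub>R E i y" for i
    by (simp add: A linear_scale[OF linear_jacobi[OF ac]] power2_eq_square)
  then have e2: "cyclic_sum (R p) (jacobi R p \<circ> jacobi R p) (E 1 y) (E 2 y) (E 3 y) = 0"
    by (rule cyclic_sum_eigenvectors[OF ac, where l = "\<lambda>i. l i y" and m = "\<lambda>i. (l i y)\<^sup>2" and e = "\<lambda>i. E i y", OF _ _ G T]) auto
  have 2: "cyclic_sum (R p) (jacobi R p \<circ> jacobi R p) u v w = 0" for u v w
    by (rule cyclic_sum_eq_0[OF ac _ _ _ e2 span])
      (simp_all add: linear_compose[OF linear_jacobi[OF ac] linear_jacobi[OF ac], unfolded comp_def] comp_def
        jacobi_radial[OF ac] linear_0[OF linear_jacobi[OF ac]] jacobi_self_adjoint[OF ac])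
  show ?thesis unfolding integrability_conditions_def using 1 2 by blast
qed

lemma integrability_conditions_on_sphere:
  fixes K :: "'a::euclidean_space \<Rightarrow> 'a \<Rightarrow> 'a \<Rightarrow> real"
  assumes dim: "DIM('a) = 4" and R: "curvature_tensor_of R K" and int: "integrable_tensor K"
  shows "\<forall>x. norm x = 1 \<longrightarrow> integrability_conditions R x"
proof -
  have ac: "algebraic_curvature_tensor R" using R unfolding curvature_tensor_of_def by blast
  obtain D where D: "sphere 0 1 \<subseteq> closure D" "\<And>p. p \<in> D \<Longrightarrow> integrability_conditions R p"
    using int integrable_imp_conditions_on_coordinate_patch[OF dim R] unfolding integrable_tensor_def by metis
  have cj: "continuous_on UNIV (\<lambda>x. jacobi R x (g x))" if "continuous_on UNIV g" for g
    unfolding jacobi_def by (intro continuous_intros continuous_on_curvature[OF ac] that)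
  have "closed {x. cyclic_sum (R x) (jacobi R x) u v w = 0}"
    "closed {x. cyclic_sum (R x) (jacobi R x \<circ> jacobi R x) u v w = 0}" for u v w
    unfolding cyclic_sum_def comp_def
    by (intro closed_Collect_eq continuous_intros continuous_on_curvature[OF ac] cj)+
  then have "closed {x. integrability_conditions R x}"
    unfolding integrability_conditions_def by (intro closed_Collect_conj closed_Collect_all)
  then have "closure D \<subseteq> {x. integrability_conditions R x}"
    using D(2) by (intro closure_minimal) auto
  then show ?thesis using D(1) by auto
qed

section \<open>Frames and bivectors\<close>

definition alternating :: "('a::real_vector \<Rightarrow> 'a \<Rightarrow> real) \<Rightarrow> bool" where
  "alternating \<omega> \<longleftrightarrow> (\<forall>v. linear (\<lambda>u. \<omega> u v)) \<and> (\<forall>u. linear (\<omega> u)) \<and> (\<forall>u v. \<omega> v u = - \<omega> u v)"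

type_synonym 'a frame = "'a \<times> 'a \<times> 'a \<times> 'a"

definition frame :: "'a::euclidean_space frame \<Rightarrow> bool" where
  "frame = (\<lambda>(f0, f1, f2, f3).
     f0 \<bullet> f0 = 1 \<and> f1 \<bullet> f1 = 1 \<and> f2 \<bullet> f2 = 1 \<and> f3 \<bullet> f3 = 1 \<and>
     f0 \<bullet> f1 = 0 \<and> f0 \<bullet> f2 = 0 \<and> f0 \<bullet> f3 = 0 \<and> f1 \<bullet> f2 = 0 \<and> f1 \<bullet> f3 = 0 \<and> f2 \<bullet> f3 = 0)"

text \<open>For \<open>s = 1\<close> (\<open>s = -1\<close>) the values of \<open>\<omega>\<close> on a basis of the self-dual (anti-self-dual) bivectors
  of the frame.\<close>

definition bivec :: "real \<Rightarrow> ('a \<Rightarrow> 'a \<Rightarrow> real) \<Rightarrow> 'a frame \<Rightarrow> real^3" where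
  "bivec s \<omega> = (\<lambda>(f0, f1, f2, f3).
     vector [\<omega> f0 f1 + s * \<omega> f2 f3, \<omega> f0 f2 + s * \<omega> f3 f1, \<omega> f0 f3 + s * \<omega> f1 f2])"

text \<open>For signs 1 1, -1 -1 and 1 -1 these are the blocks \<open>W\<^sub>+\<close>,
  \<open>W\<^sub>-\<close> and \<open>Z\<close> of the overview, in orthogonal bases of bivectors
  that are not normalised.\<close>

definition block :: "real \<Rightarrow> real \<Rightarrow> ('a \<Rightarrow> 'a \<Rightarrow> 'a \<Rightarrow> 'a \<Rightarrow> real) \<Rightarrow> 'a frame \<Rightarrow> 3 \<Rightarrow> 3 \<Rightarrow> real" where
  "block s t R f i j = bivec s (\<lambda>u v. bivec t (R u v) f $ j) f $ i"

lemma alternatingD: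
  assumes "alternating \<omega>"
  shows "\<omega> (u + u') v = \<omega> u v + \<omega> u' v" "\<omega> (u - u') v = \<omega> u v - \<omega> u' v" "\<omega> (c *\<^sub>R u) v = c * \<omega> u v"
    "\<omega> (- u) v = - \<omega> u v"
    "\<omega> w (u + u') = \<omega> w u + \<omega> w u'" "\<omega> w (u - u') = \<omega> w u - \<omega> w u'" "\<omega> w (c *\<^sub>R u) = c * \<omega> w u"
    "\<omega> w (- u) = - \<omega> w u"
    "\<omega> v u = - \<omega> u v" "\<omega> u u = 0"
proof -
  have 1: "linear (\<lambda>u. \<omega> u v)" "linear (\<omega> u)" and 2: "\<omega> v u = - \<omega> u v" for u v
    using assms unfolding alternating_def by blast+
  show "\<omega> (u + u') v = \<omega> u v + \<omega> u' v" "\<omega> (u - u') v = \<omega> u v - \<omega> u' v" "\<omega> (c *\<^sub>R u) v = c * \<omega> u v"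
    "\<omega> (- u) v = - \<omega> u v"
    using linear_add[OF 1(1)[of v]] linear_diff[OF 1(1)[of v]] linear_scale[OF 1(1)[of v]] linear_neg[OF 1(1)[of v]]
    by simp_all
  show "\<omega> w (u + u') = \<omega> w u + \<omega> w u'" "\<omega> w (u - u') = \<omega> w u - \<omega> w u'" "\<omega> w (c *\<^sub>R u) = c * \<omega> w u"
    "\<omega> w (- u) = - \<omega> w u"
    using linear_add[OF 1(2)[of w]] linear_diff[OF 1(2)[of w]] linear_scale[OF 1(2)[of w]] linear_neg[OF 1(2)[of w]]
    by simp_all
  show "\<omega> v u = - \<omega> u v" by (rule 2)
  show "\<omega> u u = 0" using 2[of u u] by simp
qed

text \<open>In quaternionic notation with \<open>f\<^sub>i = p\<^sub>i f\<^sub>0\<close>, this is right multiplication by a unit quaternion; it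
  leaves the imaginary units \<open>p\<^sub>i\<close>, that is, the self-dual bivectors, unchanged.\<close>

fun turn_frame :: "real \<Rightarrow> real \<Rightarrow> 'a::euclidean_space frame \<Rightarrow> 'a frame" where
  "turn_frame c s (f0, f1, f2, f3) =
     (c *\<^sub>R f0 + s *\<^sub>R f1, c *\<^sub>R f1 - s *\<^sub>R f0, c *\<^sub>R f2 - s *\<^sub>R f3, c *\<^sub>R f3 + s *\<^sub>R f2)"

lemma frame_turn:
  assumes "frame f" "c\<^sup>2 + s\<^sup>2 = 1"
  shows "frame (turn_frame c s f)"
proof (cases f)
  case (fields f0 f1 f2 f3)
  have "c * c + s * s = 1" using assms(2) by (simp add: power2_eq_square)
  then show ?thesis
    using assms(1) unfolding fields frame_def
    by (simp add: inner_add_left inner_add_right inner_diff_left inner_diff_right inner_commute algebra_simps)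
qed

lemma bivec_turn_self_dual:
  assumes "alternating \<omega>" "c\<^sup>2 + s\<^sup>2 = 1"
  shows "bivec 1 \<omega> (turn_frame c s f) = bivec 1 \<omega> f"
proof (cases f)
  case (fields f0 f1 f2 f3)
  note a = alternatingD[OF assms(1)]
  have c: "c * c = 1 - s * s" using assms(2) by (simp add: power2_eq_square)
  have cx: "c * (c * x) = x - s * (s * x)" for x
    using c by (metis (no_types) mult.assoc left_diff_distrib mult_1)
  show ?thesis
    unfolding fields bivec_def
    by (simp add: vec_eq_iff forall_3 a(1-8,10) a(9)[of f1 f0] a(9)[of f2 f0] a(9)[of f3 f0]
        a(9)[of f2 f1] a(9)[of f3 f1] a(9)[of f3 f2] cx algebra_simps)
qed

lemma bivec_turn_anti_self_dual:
  assumes "alternating \<omega>" "c\<^sup>2 + s\<^sup>2 = 1"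
  shows "bivec (-1) \<omega> (turn_frame c s f) =
    (let q = bivec (-1) \<omega> f; C = c\<^sup>2 - s\<^sup>2; S = 2 * c * s
     in vector [q$1, C * q$2 - S * q$3, S * q$2 + C * q$3])"
proof (cases f)
  case (fields f0 f1 f2 f3)
  note a = alternatingD[OF assms(1)]
  have c: "c * c = 1 - s * s" using assms(2) by (simp add: power2_eq_square)
  have cx: "c * (c * x) = x - s * (s * x)" for x
    using c by (metis (no_types) mult.assoc left_diff_distrib mult_1)
  show ?thesis
    unfolding fields bivec_def Let_def
    by (simp add: vec_eq_iff forall_3 a(1-8,10) a(9)[of f1 f0] a(9)[of f2 f0] a(9)[of f3 f0]
        a(9)[of f2 f1] a(9)[of f3 f1] a(9)[of f3 f2] power2_eq_square cx algebra_simps)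
qed

text \<open>Turning the frame by an angle turns the anti-self-dual bivectors by twice that angle, so
  half the angle is used. Every rotation about the first axis arises in this way.\<close>

lemma bivec_rotate:
  assumes "frame f" "C\<^sup>2 + S\<^sup>2 = 1"
  obtains f' where "frame f'" "\<And>\<omega>. alternating \<omega> \<Longrightarrow> bivec 1 \<omega> f' = bivec 1 \<omega> f"
    "\<And>\<omega>. alternating \<omega> \<Longrightarrow> bivec (-1) \<omega> f' =
       vector [bivec (-1) \<omega> f $ 1, C * bivec (-1) \<omega> f $ 2 - S * bivec (-1) \<omega> f $ 3,
         S * bivec (-1) \<omega> f $ 2 + C * bivec (-1) \<omega> f $ 3]"
proof -
  obtain t where t: "C = cos t" "S = sin t" using sincos_total_2pi assms(2) by metis
  let ?c = "cos (t/2)" let ?s = "sin (t/2)"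
  have cs: "?c\<^sup>2 + ?s\<^sup>2 = 1" by simp
  have "C = ?c\<^sup>2 - ?s\<^sup>2" "S = 2 * ?c * ?s"
    using cos_double[of "t/2"] sin_double[of "t/2"] t by simp_all
  then show ?thesis
    using that[of "turn_frame ?c ?s f", OF frame_turn[OF assms(1) cs] bivec_turn_self_dual[OF _ cs]]
      bivec_turn_anti_self_dual[OF _ cs, of _ f] by (simp add: Let_def)
qed

text \<open>The cycle permutes the three axes of both kinds of bivectors, and the flip reverses
  orientation and so exchanges the two kinds up to a sign that cancels in the blocks. It therefore
  suffices to study anti-self-dual rotations about the first axis.\<close>

fun cycle_frame :: "'a frame \<Rightarrow> 'a frame" where "cycle_frame (f0, f1, f2, f3) = (f0, f2, f3, f1)"
fun flip_frame :: "'a::euclidean_space frame \<Rightarrow> 'a frame" where "flip_frame (f0, f1, f2, f3) = (- f0, f1, f2, f3)"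

lemma frame_cycle: "frame f \<Longrightarrow> frame (cycle_frame f)"
  by (cases f) (simp add: frame_def inner_commute)

lemma frame_flip: "frame f \<Longrightarrow> frame (flip_frame f)"
  by (cases f) (simp add: frame_def)

lemma bivec_cycle: "bivec s \<omega> (cycle_frame f) = vector [bivec s \<omega> f $ 2, bivec s \<omega> f $ 3, bivec s \<omega> f $ 1]"
  by (cases f) (simp add: bivec_def)

lemma bivec_flip: "alternating \<omega> \<Longrightarrow> bivec s \<omega> (flip_frame f) = - bivec (- s) \<omega> f"
  by (cases f) (simp add: bivec_def vec_eq_iff forall_3 alternatingD(4,8))

context
  fixes R :: "'a::euclidean_space \<Rightarrow> 'a \<Rightarrow> 'a \<Rightarrow> 'a \<Rightarrow> real"
  assumes ac: "algebraic_curvature_tensor R"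
begin

lemma alternating_curvature: "alternating (R u v)" "alternating (\<lambda>u v. R u v u' v')"
  unfolding alternating_def using algebraic_curvature_tensorD[OF ac] by blast+

lemma linear_bivec:
  assumes "\<And>u v. linear (\<lambda>x. \<omega> x u v)"
  shows "linear (\<lambda>x. bivec s (\<omega> x) f $ i)"
proof -
  have "\<forall>i. linear (\<lambda>x. bivec s (\<omega> x) f $ i)"
    by (cases f) (auto simp: forall_3 bivec_def linear_iff
        linear_add[OF assms] linear_scale[OF assms] algebra_simps)
  then show ?thesis by blast
qed

lemma alternating_bivec: "alternating (\<lambda>u v. bivec t (R u v) f $ j)"
proof -
  note D = algebraic_curvature_tensorD[OF ac]
  have "\<forall>j. bivec t (R v u) f $ j = - bivec t (R u v) f $ j" for u v
    by (cases f) (simp add: forall_3 bivec_def D(5)[of v u] algebra_simps)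
  moreover have "linear (\<lambda>u. bivec t (R u v) f $ j)" "linear (\<lambda>v. bivec t (R u v) f $ j)" for u v
    by (rule linear_bivec, rule D)+
  ultimately show ?thesis unfolding alternating_def by blast
qed

lemma block_transpose: "block s t R f i j = block t s R f j i"
proof -
  have "\<forall>i j. block s t R f i j = block t s R f j i"
    using algebraic_curvature_tensorD(7)[OF ac]
    by (cases f) (simp add: forall_3 block_def bivec_def algebra_simps)
  then show ?thesis by blast
qed

lemma block_cycle:
  "block s t R (cycle_frame f) i j = block s t R f (if i = 1 then 2 else if i = 2 then 3 else 1)
     (if j = 1 then 2 else if j = 2 then 3 else 1)"
proof -
  have "\<forall>i j. block s t R (cycle_frame f) i j = block s t R f (if i = 1 then 2 else if i = 2 then 3 else 1)
     (if j = 1 then 2 else if j = 2 then 3 else 1)"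
    unfolding block_def bivec_cycle forall_3 by simp
  then show ?thesis by blast
qed

lemma block_flip: "block s t R (flip_frame f) i j = block (- s) (- t) R f i j"
proof -
  have neg: "bivec s (\<lambda>u v. - \<omega> u v) g = - bivec s \<omega> g" for s \<omega> and g :: "'a frame"
    by (cases g) (simp add: bivec_def vec_eq_iff forall_3)
  have "block s t R (flip_frame f) i j = bivec s (\<lambda>u v. - (bivec (- t) (R u v) f $ j)) (flip_frame f) $ i"
    by (simp only: block_def bivec_flip[OF alternating_curvature(1)] vector_uminus_component)
  also have "\<dots> = - (bivec s (\<lambda>u v. bivec (- t) (R u v) f $ j) (flip_frame f) $ i)"
    by (simp only: neg vector_uminus_component)
  also have "\<dots> = block (- s) (- t) R f i j"
    by (simp only: bivec_flip[OF alternating_bivec] vector_uminus_component block_def minus_minus)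
  finally show ?thesis .
qed

end

section \<open>The integrability conditions as trace identities\<close>

lemma frame_expansion:
  fixes v :: "'a::euclidean_space"
  assumes "DIM('a) = 4" "frame (f0, f1, f2, f3)"
  shows "v = (v \<bullet> f0) *\<^sub>R f0 + (v \<bullet> f1) *\<^sub>R f1 + (v \<bullet> f2) *\<^sub>R f2 + (v \<bullet> f3) *\<^sub>R f3"
proof -
  define w where "w = v - ((v \<bullet> f0) *\<^sub>R f0 + (v \<bullet> f1) *\<^sub>R f1 + (v \<bullet> f2) *\<^sub>R f2 + (v \<bullet> f3) *\<^sub>R f3)"
  note f = assms(2)[unfolded frame_def, simplified]
  have w: "w \<bullet> f0 = 0" "w \<bullet> f1 = 0" "w \<bullet> f2 = 0" "w \<bullet> f3 = 0"
    using f inner_commute[of f1 f0] inner_commute[of f2 f0] inner_commute[of f3 f0]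
      inner_commute[of f2 f1] inner_commute[of f3 f1] inner_commute[of f3 f2]
    by (simp_all add: w_def inner_diff_left inner_add_left)
  have "w = 0"
  proof (rule ccontr)
    assume nz: "w \<noteq> 0"
    have ne: "f0 \<noteq> 0" "f1 \<noteq> 0" "f2 \<noteq> 0" "f3 \<noteq> 0" using f by auto
    have d: "f0 \<noteq> f1" "f0 \<noteq> f2" "f0 \<noteq> f3" "f1 \<noteq> f2" "f1 \<noteq> f3" "f2 \<noteq> f3"
      "w \<noteq> f0" "w \<noteq> f1" "w \<noteq> f2" "w \<noteq> f3" using f w ne nz by auto
    have "independent {w, f0, f1, f2, f3}"
      by (rule pairwise_orthogonal_independent)
         (use f w ne nz in \<open>auto simp: pairwise_def orthogonal_def inner_commute\<close>)
    then have "card {w, f0, f1, f2, f3} \<le> 4" using independent_bound assms(1) by metis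
    then show False using d by simp
  qed
  then show ?thesis unfolding w_def by simp
qed

text \<open>The plane of f0 and fi is half the sum of the self-dual and the anti-self-dual basis
  bivector, and its dual plane is half their difference. So \<open>radial_block\<close> is the
  matrix of R(f0, fi, f0, fj), that is, of the Jacobi operator at f0, and
  \<open>dual_radial_block\<close> replaces the second plane by its dual.\<close>

definition radial_block :: "('a \<Rightarrow> 'a \<Rightarrow> 'a \<Rightarrow> 'a \<Rightarrow> real) \<Rightarrow> 'a frame \<Rightarrow> 3 \<Rightarrow> 3 \<Rightarrow> real" where
  "radial_block R f i j =
     (block 1 1 R f i j + block 1 (-1) R f i j + block (-1) 1 R f i j + block (-1) (-1) R f i j) / 4"

definition dual_radial_block :: "('a \<Rightarrow> 'a \<Rightarrow> 'a \<Rightarrow> 'a \<Rightarrow> real) \<Rightarrow> 'a frame \<Rightarrow> 3 \<Rightarrow> 3 \<Rightarrow> real" where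
  "dual_radial_block R f i j =
     (block 1 1 R f i j - block 1 (-1) R f i j + block (-1) 1 R f i j - block (-1) (-1) R f i j) / 4"

text \<open>With A the radial and B the dual radial block at x = f0, the Bianchi identity is tr B =
  0, and the two cyclic sums on f1, f2, f3 are tr(AB) and tr(AAB).\<close>

lemma trace_conditions:
  fixes f :: "'a::euclidean_space frame"
  assumes ac: "algebraic_curvature_tensor R" and dim: "DIM('a) = 4" and f: "frame f"
    and int: "\<forall>x. norm x = 1 \<longrightarrow> integrability_conditions R x"
  shows "(\<Sum>i\<in>UNIV. dual_radial_block R f i i) = 0"
    and "(\<Sum>i\<in>UNIV. \<Sum>j\<in>UNIV. radial_block R f i j * dual_radial_block R f j i) = 0"
    and "(\<Sum>i\<in>UNIV. \<Sum>j\<in>UNIV. \<Sum>k\<in>UNIV. radial_block R f i j * radial_block R f j k * dual_radial_block R f k i) = 0"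
proof -
  obtain f0 f1 f2 f3 where fe: "f = (f0, f1, f2, f3)" by (cases f)
  note D = algebraic_curvature_tensorD[OF ac]
  let ?A = "\<lambda>v w. R f0 v f0 w" and ?B = "\<lambda>v u w. R f0 v u w"
  have A: "radial_block R f 1 1 = ?A f1 f1" "radial_block R f 1 2 = ?A f1 f2" "radial_block R f 1 3 = ?A f1 f3"
    "radial_block R f 2 1 = ?A f2 f1" "radial_block R f 2 2 = ?A f2 f2" "radial_block R f 2 3 = ?A f2 f3"
    "radial_block R f 3 1 = ?A f3 f1" "radial_block R f 3 2 = ?A f3 f2" "radial_block R f 3 3 = ?A f3 f3"
    by (simp_all add: radial_block_def block_def bivec_def fe)
  have B: "dual_radial_block R f 1 1 = ?B f1 f2 f3" "dual_radial_block R f 1 2 = ?B f1 f3 f1" "dual_radial_block R f 1 3 = ?B f1 f1 f2"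
    "dual_radial_block R f 2 1 = ?B f2 f2 f3" "dual_radial_block R f 2 2 = ?B f2 f3 f1" "dual_radial_block R f 2 3 = ?B f2 f1 f2"
    "dual_radial_block R f 3 1 = ?B f3 f2 f3" "dual_radial_block R f 3 2 = ?B f3 f3 f1" "dual_radial_block R f 3 3 = ?B f3 f1 f2"
    by (simp_all add: dual_radial_block_def block_def bivec_def fe)
  note z = curvature_repeated[OF ac]
  have j: "jacobi R f0 v = ?A v f1 *\<^sub>R f1 + ?A v f2 *\<^sub>R f2 + ?A v f3 *\<^sub>R f3" for v
    using frame_expansion[OF dim f[unfolded fe], of "jacobi R f0 v"]
    by (simp add: inner_jacobi[OF ac] z)
  have l: "linear (\<lambda>v. R f0 v u w)" for u w by (rule D)
  have l': "linear (\<lambda>v. R f0 v f0 w)" for w by (rule D)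
  have "norm f0 = 1" using f unfolding fe frame_def by (simp add: norm_eq_sqrt_inner)
  then have c: "integrability_conditions R f0" using int by blast
  show "(\<Sum>i\<in>UNIV. dual_radial_block R f i i) = 0"
    using D(8)[of f0 f1 f2 f3] by (simp add: sum_3 B)
  show "(\<Sum>i\<in>UNIV. \<Sum>j\<in>UNIV. radial_block R f i j * dual_radial_block R f j i) = 0"
    using c[unfolded integrability_conditions_def, THEN conjunct1, rule_format, of f1 f2 f3]
    unfolding cyclic_sum_def j by (simp add: sum_3 A B linear_add[OF l] linear_scale[OF l])
  show "(\<Sum>i\<in>UNIV. \<Sum>j\<in>UNIV. \<Sum>k\<in>UNIV. radial_block R f i j * radial_block R f j k * dual_radial_block R f k i) = 0"
    using c[unfolded integrability_conditions_def, THEN conjunct2, rule_format, of f1 f2 f3]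
    unfolding cyclic_sum_def comp_def j
    by (simp add: sum_3 A B linear_add[OF l] linear_scale[OF l] linear_add[OF l'] linear_scale[OF l']
        algebra_simps)
qed

definition has_blocks ::
    "('a::euclidean_space \<Rightarrow> 'a \<Rightarrow> 'a \<Rightarrow> 'a \<Rightarrow> real) \<Rightarrow> 'a frame \<Rightarrow> real^3 \<Rightarrow> real^3 \<Rightarrow> real^3^3 \<Rightarrow> bool" where
  "has_blocks R f a b z \<longleftrightarrow> frame f \<and>
     (\<forall>i j. block 1 1 R f i j = (if i = j then a $ i else 0)) \<and>
     (\<forall>i j. block (-1) (-1) R f i j = (if i = j then b $ i else 0)) \<and>
     (\<forall>i j. block 1 (-1) R f i j = z $ i $ j)"

lemma has_blocks_cycle:
  assumes "algebraic_curvature_tensor R" "has_blocks R f a b z"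
  shows "has_blocks R (cycle_frame f) (vector [a$2, a$3, a$1]) (vector [b$2, b$3, b$1])
    (vector [vector [z$2$2, z$2$3, z$2$1], vector [z$3$2, z$3$3, z$3$1], vector [z$1$2, z$1$3, z$1$1]])"
  using assms(2) frame_cycle[of f] unfolding has_blocks_def block_cycle[OF assms(1)] forall_3
  by simp

definition rotate_23 :: "real \<Rightarrow> real \<Rightarrow> real^3 \<Rightarrow> real^3" where
  "rotate_23 C S v = vector [v$1, C * v$2 - S * v$3, S * v$2 + C * v$3]"

lemma block_rotate:
  assumes ac: "algebraic_curvature_tensor R" and f: "frame f" and CS: "C\<^sup>2 + S\<^sup>2 = 1"
  obtains f' where "frame f'" "\<And>i j. block 1 1 R f' i j = block 1 1 R f i j"
    "\<And>i j. block 1 (-1) R f' i j = rotate_23 C S (\<chi> j. block 1 (-1) R f i j) $ j"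
    "\<And>i j. block (-1) (-1) R f' i j = rotate_23 C S (\<chi> i. rotate_23 C S (\<chi> j. block (-1) (-1) R f i j) $ j) $ i"
proof -
  obtain f' where f': "frame f'" "\<And>\<omega>. alternating \<omega> \<Longrightarrow> bivec 1 \<omega> f' = bivec 1 \<omega> f"
    "\<And>\<omega>. alternating \<omega> \<Longrightarrow> bivec (-1) \<omega> f' = rotate_23 C S (bivec (-1) \<omega> f)"
    using bivec_rotate[OF f CS] unfolding rotate_23_def by metis
  note R = alternating_curvature(1)[OF ac] and B = alternating_bivec[OF ac]
  have comm: "bivec s (\<lambda>u v. rotate_23 C S (W u v) $ j) f $ i = rotate_23 C S (\<chi> j. bivec s (\<lambda>u v. W u v $ j) f $ i) $ j"
    for s i j and W :: "'a \<Rightarrow> 'a \<Rightarrow> real^3"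
  proof -
    have "\<forall>i j. bivec s (\<lambda>u v. rotate_23 C S (W u v) $ j) f $ i =
        rotate_23 C S (\<chi> j. bivec s (\<lambda>u v. W u v $ j) f $ i) $ j"
      by (cases f) (simp add: forall_3 rotate_23_def bivec_def algebra_simps)
    then show ?thesis by blast
  qed
  have "block 1 1 R f' i j = block 1 1 R f i j" for i j
    by (simp only: block_def f'(2)[OF B] f'(2)[OF R])
  moreover have "block 1 (-1) R f' i j = rotate_23 C S (\<chi> j. block 1 (-1) R f i j) $ j" for i j
    by (simp only: block_def f'(2)[OF B]) (simp only: f'(3)[OF R] comm)
  moreover have "block (-1) (-1) R f' i j =
      rotate_23 C S (\<chi> i. rotate_23 C S (\<chi> j. block (-1) (-1) R f i j) $ j) $ i" for i j
  proof -
    have "block (-1) (-1) R f' i j = rotate_23 C S (\<chi> i. bivec (-1) (\<lambda>u v. rotate_23 C S (bivec (-1) (R u v) f) $ j) f $ i) $ i"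
      by (simp only: block_def f'(3)[OF B] vec_lambda_eta) (simp only: f'(3)[OF R])
    then show ?thesis by (simp only: comm block_def)
  qed
  ultimately show ?thesis using that f'(1) by metis
qed

text \<open>The off-diagonal entry created in the anti-self-dual block is C S (b2 - b3). It vanishes
  for half and quarter turns, and for every angle if b2 = b3.\<close>

lemma has_blocks_rotate:
  assumes ac: "algebraic_curvature_tensor R" and h: "has_blocks R f a b z"
    and CS: "C\<^sup>2 + S\<^sup>2 = 1" "C * S * (b$2 - b$3) = 0"
  shows "\<exists>f'. has_blocks R f' a (vector [b$1, C\<^sup>2 * b$2 + S\<^sup>2 * b$3, S\<^sup>2 * b$2 + C\<^sup>2 * b$3])
    (\<chi> i. rotate_23 C S (z $ i))"
proof -
  have "frame f" using h unfolding has_blocks_def by blast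
  from block_rotate[OF ac this CS(1)] obtain f' where f': "frame f'"
    "\<And>i j. block 1 1 R f' i j = block 1 1 R f i j"
    "\<And>i j. block 1 (-1) R f' i j = rotate_23 C S (\<chi> j. block 1 (-1) R f i j) $ j"
    "\<And>i j. block (-1) (-1) R f' i j = rotate_23 C S (\<chi> i. rotate_23 C S (\<chi> j. block (-1) (-1) R f i j) $ j) $ i"
    by metis
  have "C * (S * b$2) = C * (S * b$3)" using CS(2) by (simp add: algebra_simps)
  then have "has_blocks R f' a (vector [b$1, C\<^sup>2 * b$2 + S\<^sup>2 * b$3, S\<^sup>2 * b$2 + C\<^sup>2 * b$3])
    (\<chi> i. rotate_23 C S (z $ i))"
    using h f'(1) unfolding has_blocks_def f'(2-4)
    by (simp add: forall_3 rotate_23_def power2_eq_square algebra_simps)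
  then show ?thesis by blast
qed

lemma has_blocks_trace_conditions:
  fixes f :: "'a::euclidean_space frame"
  assumes ac: "algebraic_curvature_tensor R" and dim: "DIM('a) = 4"
    and int: "\<forall>x. norm x = 1 \<longrightarrow> integrability_conditions R x"
    and h: "has_blocks R f a b z"
  shows "a$1 + a$2 + a$3 = b$1 + b$2 + b$3"
    and "(a$1)\<^sup>2 + (a$2)\<^sup>2 + (a$3)\<^sup>2 - ((b$1)\<^sup>2 + (b$2)\<^sup>2 + (b$3)\<^sup>2)
      + 2 * (z$1$1 * (a$1 - b$1) + z$2$2 * (a$2 - b$2) + z$3$3 * (a$3 - b$3)) = 0"
    and "\<forall>i j. z$i$j * (a$i - b$j) = 0 \<Longrightarrow>
      (a$1 + b$1)\<^sup>2 * (a$1 - b$1) + (a$2 + b$2)\<^sup>2 * (a$2 - b$2) + (a$3 + b$3)\<^sup>2 * (a$3 - b$3)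
      + (\<Sum>i\<in>UNIV. \<Sum>j\<in>UNIV. (z$i$j)\<^sup>2 * (a$j - b$i)) = 0"
proof -
  have f: "frame f" using h unfolding has_blocks_def by blast
  note T = trace_conditions[OF ac dim f int]
  have b: "block 1 1 R f i j = (if i = j then a $ i else 0)"
    "block (-1) (-1) R f i j = (if i = j then b $ i else 0)"
    "block 1 (-1) R f i j = z $ i $ j" "block (-1) 1 R f i j = z $ j $ i" for i j
    using h block_transpose[OF ac] unfolding has_blocks_def by metis+
  have SA: "radial_block R f i j = ((if i = j then a$i + b$i else 0) + z$i$j + z$j$i) / 4" for i j
    by (simp add: radial_block_def b)
  have SB: "dual_radial_block R f i j = ((if i = j then a$i - b$i else 0) - z$i$j + z$j$i) / 4" for i j
    by (simp add: dual_radial_block_def b)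
  show "a$1 + a$2 + a$3 = b$1 + b$2 + b$3"
    using T(1) by (simp add: SB sum_3 field_simps)
  show "(a$1)\<^sup>2 + (a$2)\<^sup>2 + (a$3)\<^sup>2 - ((b$1)\<^sup>2 + (b$2)\<^sup>2 + (b$3)\<^sup>2)
      + 2 * (z$1$1 * (a$1 - b$1) + z$2$2 * (a$2 - b$2) + z$3$3 * (a$3 - b$3)) = 0"
    using T(2) by (simp add: SA SB sum_3 field_simps power2_eq_square)
  assume z: "\<forall>i j. z$i$j * (a$i - b$j) = 0"
  show "(a$1 + b$1)\<^sup>2 * (a$1 - b$1) + (a$2 + b$2)\<^sup>2 * (a$2 - b$2) + (a$3 + b$3)\<^sup>2 * (a$3 - b$3)
      + (\<Sum>i\<in>UNIV. \<Sum>j\<in>UNIV. (z$i$j)\<^sup>2 * (a$j - b$i)) = 0" (is "?L = 0")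
  proof -
    define e where "e i j = z$i$j * (a$i - b$j)" for i j
    define A where "A i j = (if i = j then a$i + b$i else 0) + z$i$j + z$j$i" for i j
    define B where "B i j = (if i = j then a$i - b$i else 0) - z$i$j + z$j$i" for i j
    have A': "A 2 1 = A 1 2" "A 3 1 = A 1 3" "A 3 2 = A 2 3"
      "B 2 1 = - B 1 2" "B 3 1 = - B 1 3" "B 3 2 = - B 2 3"
      by (simp_all add: A_def B_def)
    have "(\<Sum>i\<in>UNIV. \<Sum>j\<in>UNIV. \<Sum>k\<in>UNIV. radial_block R f i j * radial_block R f j k * dual_radial_block R f k i)
      = (\<Sum>i\<in>UNIV. \<Sum>j\<in>UNIV. \<Sum>k\<in>UNIV. A i j * A j k * B k i) / 64"
      by (simp add: SA SB A_def[symmetric] B_def[symmetric] sum_divide_distrib)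
    \<comment> \<open>The square of the symmetric \<open>A\<close> is symmetric, so the skew
      off-diagonal part of \<open>B\<close> contributes nothing to the trace.\<close>
    also have "(\<Sum>i\<in>UNIV. \<Sum>j\<in>UNIV. \<Sum>k\<in>UNIV. A i j * A j k * B k i) = (\<Sum>i\<in>UNIV. \<Sum>j\<in>UNIV. (A i j)\<^sup>2 * B i i)"
      unfolding sum_3 A' by (simp add: algebra_simps power2_eq_square)
    \<comment> \<open>The remainder is collected into multiples of \<open>e\<close>, which is zero
      by assumption.\<close>
    also have "\<dots> = ?L + (\<Sum>i\<in>UNIV. \<Sum>j\<in>UNIV. z$i$j * e i j + z$j$i * e i j + z$i$j * e j i)
        + 4 * (\<Sum>i\<in>UNIV. (a$i + b$i) * e i i)"
      unfolding sum_3 A_def B_def e_def by (simp add: algebra_simps power2_eq_square)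
    finally have "?L + (\<Sum>i\<in>UNIV. \<Sum>j\<in>UNIV. z$i$j * e i j + z$j$i * e i j + z$i$j * e j i)
        + 4 * (\<Sum>i\<in>UNIV. (a$i + b$i) * e i i) = 0" using T(3) by simp
    moreover have "e i j = 0" for i j using z unfolding e_def by blast
    ultimately show ?thesis by simp
  qed
qed

section \<open>Spectra of the self-dual and anti-self-dual blocks\<close>

lemma has_blocks_flip:
  assumes "algebraic_curvature_tensor R" "has_blocks R f a b z"
  shows "has_blocks R (flip_frame f) b a (transpose z)"
  using assms(2) frame_flip[of f] block_transpose[OF assms(1), of "-1" 1]
  unfolding has_blocks_def block_flip[OF assms(1)] transpose_def by simp

context
  fixes R :: "'a::euclidean_space \<Rightarrow> 'a \<Rightarrow> 'a \<Rightarrow> 'a \<Rightarrow> real"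
  assumes ac: "algebraic_curvature_tensor R" and dim: "DIM('a) = 4"
    and int: "\<forall>x. norm x = 1 \<longrightarrow> integrability_conditions R x"
begin

lemmas blocks_trace_conditions = has_blocks_trace_conditions[OF ac dim int]

text \<open>A half turn about the first axis fixes both diagonal blocks and negates the second and
  third columns of \<open>z\<close>.\<close>

lemma half_turn_condition:
  assumes "has_blocks R f a b z"
  shows "(a$1)\<^sup>2 + (a$2)\<^sup>2 + (a$3)\<^sup>2 - ((b$1)\<^sup>2 + (b$2)\<^sup>2 + (b$3)\<^sup>2)
      + 2 * (z$1$1 * (a$1 - b$1) - z$2$2 * (a$2 - b$2) - z$3$3 * (a$3 - b$3)) = 0"
proof -
  have "\<exists>f'. has_blocks R f' a (vector [b$1, (-1)\<^sup>2 * b$2 + 0\<^sup>2 * b$3, 0\<^sup>2 * b$2 + (-1)\<^sup>2 * b$3])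
    (\<chi> i. rotate_23 (-1) 0 (z $ i))"
    by (rule has_blocks_rotate[OF ac assms]) simp_all
  then obtain f' where "has_blocks R f' a (vector [b$1, (-1)\<^sup>2 * b$2 + 0\<^sup>2 * b$3, 0\<^sup>2 * b$2 + (-1)\<^sup>2 * b$3])
    (\<chi> i. rotate_23 (-1) 0 (z $ i))" ..
  from blocks_trace_conditions(2)[OF this] show ?thesis by (simp add: rotate_23_def algebra_simps)
qed

text \<open>The original identity and its three half-turn variants are four linear equations in the
  difference of the square sums and the three products, with sign patterns +++, +--, -+-, --+. Hence
  all four unknowns vanish.\<close>

lemma diagonal_condition:
  assumes h: "has_blocks R f a b z"
  shows "(a$1)\<^sup>2 + (a$2)\<^sup>2 + (a$3)\<^sup>2 = (b$1)\<^sup>2 + (b$2)\<^sup>2 + (b$3)\<^sup>2"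
    and "z$1$1 * (a$1 - b$1) = 0" "z$2$2 * (a$2 - b$2) = 0" "z$3$3 * (a$3 - b$3) = 0"
proof -
  note h' = has_blocks_cycle[OF ac h]
  note h'' = has_blocks_cycle[OF ac h']
  note t = blocks_trace_conditions(2)[OF h] half_turn_condition[OF h] half_turn_condition[OF h'] half_turn_condition[OF h'']
  show "(a$1)\<^sup>2 + (a$2)\<^sup>2 + (a$3)\<^sup>2 = (b$1)\<^sup>2 + (b$2)\<^sup>2 + (b$3)\<^sup>2"
    and "z$1$1 * (a$1 - b$1) = 0" "z$2$2 * (a$2 - b$2) = 0" "z$3$3 * (a$3 - b$3) = 0"
    using t unfolding vector_3 by argo+
qed

lemma has_blocks_quarter_turn:
  assumes "has_blocks R f a b z"
  obtains f' where "has_blocks R f' a (vector [b$1, b$3, b$2]) (\<chi> i. vector [z$i$1, - z$i$3, z$i$2])"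
  using has_blocks_rotate[OF ac assms, of 0 1] by (simp add: rotate_23_def) blast

text \<open>A quarter turn brings these two entries of \<open>z\<close> onto the diagonal, up to
  sign, and swaps b2 with b3, so that \<open>diagonal_condition\<close> applies.\<close>

lemma off_diagonal_condition:
  assumes h: "has_blocks R f a b z"
  shows "z$2$3 * (a$2 - b$3) = 0" "z$3$2 * (a$3 - b$2) = 0"
proof -
  obtain f' where "has_blocks R f' a (vector [b$1, b$3, b$2]) (\<chi> i. vector [z$i$1, - z$i$3, z$i$2])"
    using has_blocks_quarter_turn[OF h] .
  from diagonal_condition[OF this] show "z$2$3 * (a$2 - b$3) = 0" "z$3$2 * (a$3 - b$2) = 0" by simp_all
qed

text \<open>This is \<open>W\<^sub>+ Z = Z W\<^sub>-\<close> entry by entry; cyclic shifts reach the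
  entries not covered directly.\<close>

lemma intertwining:
  assumes h: "has_blocks R f a b z"
  shows "z$i$j * (a$i - b$j) = 0"
proof -
  note h' = has_blocks_cycle[OF ac h]
  note h'' = has_blocks_cycle[OF ac h']
  have "\<forall>i j. z$i$j * (a$i - b$j) = 0"
    unfolding forall_3
    using diagonal_condition(2-4)[OF h] off_diagonal_condition[OF h]
      off_diagonal_condition[OF h'] off_diagonal_condition[OF h''] unfolding vector_3 by blast
  then show ?thesis by blast
qed

lemma cubic_condition:
  assumes h: "has_blocks R f a b z"
  shows "(a$1 + b$1)\<^sup>2 * (a$1 - b$1) + (a$2 + b$3)\<^sup>2 * (a$2 - b$3) + (a$3 + b$2)\<^sup>2 * (a$3 - b$2)
    + (((z$1$1)\<^sup>2 * (a$1 - b$1) + (z$1$3)\<^sup>2 * (a$2 - b$1) + (z$1$2)\<^sup>2 * (a$3 - b$1))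
     + ((z$2$1)\<^sup>2 * (a$1 - b$3) + (z$2$3)\<^sup>2 * (a$2 - b$3) + (z$2$2)\<^sup>2 * (a$3 - b$3))
     + ((z$3$1)\<^sup>2 * (a$1 - b$2) + (z$3$3)\<^sup>2 * (a$2 - b$2) + (z$3$2)\<^sup>2 * (a$3 - b$2))) = 0"
proof -
  obtain f' where h': "has_blocks R f' a (vector [b$1, b$3, b$2]) (\<chi> i. vector [z$i$1, - z$i$3, z$i$2])"
    using has_blocks_quarter_turn[OF h] .
  from blocks_trace_conditions(3)[OF h'] intertwining[OF h'] show ?thesis by (simp add: sum_3)
qed

text \<open>The quarter turns about the three axes transpose two eigenvalues of the anti-self-dual block each.
  In the sum of the three resulting conditions all mixed terms cancel.\<close>

lemma power_sums:
  assumes h: "has_blocks R f a b z"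
  shows "(a$1)^3 + (a$2)^3 + (a$3)^3 = (b$1)^3 + (b$2)^3 + (b$3)^3"
proof -
  note h' = has_blocks_cycle[OF ac h]
  note h'' = has_blocks_cycle[OF ac h']
  note c = cubic_condition[OF h] cubic_condition[OF h'] cubic_condition[OF h'']
  define p where "p = a$1 + a$2 + a$3 - (b$1 + b$2 + b$3)"
  define q where "q = (a$1)\<^sup>2 + (a$2)\<^sup>2 + (a$3)\<^sup>2 - ((b$1)\<^sup>2 + (b$2)\<^sup>2 + (b$3)\<^sup>2)"
  \<comment> \<open>Among the three transpositions each pair of indices i, j is matched exactly
    once. So the mixed terms in \<open>a\<close> and \<open>b\<close> add up to products of full
    sums, and each squared entry of \<open>z\<close> gets the coefficient \<open>p\<close>.\<close>
  have "0 = 3 * ((a$1)^3 + (a$2)^3 + (a$3)^3 - ((b$1)^3 + (b$2)^3 + (b$3)^3))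
     + q * (a$1 + a$2 + a$3) - p * ((a$1)\<^sup>2 + (a$2)\<^sup>2 + (a$3)\<^sup>2)
     + p * ((z$1$1)\<^sup>2 + (z$1$2)\<^sup>2 + (z$1$3)\<^sup>2 + (z$2$1)\<^sup>2 + (z$2$2)\<^sup>2 + (z$2$3)\<^sup>2
        + (z$3$1)\<^sup>2 + (z$3$2)\<^sup>2 + (z$3$3)\<^sup>2)"
    using c unfolding vector_3 p_def q_def
    by (simp add: algebra_simps power2_eq_square power3_eq_cube)
  moreover have "p = 0" "q = 0"
    using blocks_trace_conditions(1)[OF h] diagonal_condition(1)[OF h] by (simp_all add: p_def q_def)
  ultimately show ?thesis by simp
qed

end

section \<open>Power sums and extremality on the circle\<close>

lemma sorted_triples_eq:
  fixes a1 :: real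
  assumes s: "a1 \<ge> a2" "a2 \<ge> a3" "b1 \<ge> b2" "b2 \<ge> b3"
    and p: "a1 + a2 + a3 = b1 + b2 + b3" "a1\<^sup>2 + a2\<^sup>2 + a3\<^sup>2 = b1\<^sup>2 + b2\<^sup>2 + b3\<^sup>2"
      "a1^3 + a2^3 + a3^3 = b1^3 + b2^3 + b3^3"
  shows "a1 = b1 \<and> a2 = b2 \<and> a3 = b3"
proof -
  have root: "(x1 - y1) * (x1 - y2) * (x1 - y3) = 0"
    if "x1 + x2 + x3 = y1 + y2 + y3" "x1\<^sup>2 + x2\<^sup>2 + x3\<^sup>2 = y1\<^sup>2 + y2\<^sup>2 + y3\<^sup>2"
      "x1^3 + x2^3 + x3^3 = y1^3 + y2^3 + y3^3" for x1 x2 x3 y1 y2 y3 :: real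
  proof -
    \<comment> \<open>By Newton's identities equal power sums give equal elementary symmetric
      functions, so x1 is a root of the cubic with roots y1, y2, y3. The factor 6 clears the
      denominators.\<close>
    have "6 * ((x1 - y1) * (x1 - y2) * (x1 - y3)) = 0"
      using that by algebra
    then show ?thesis by simp
  qed
  have "a1 = b1 \<or> a1 = b2 \<or> a1 = b3" using root[OF p] by auto
  moreover have "b1 = a1 \<or> b1 = a2 \<or> b1 = a3" using root[OF p[symmetric]] by auto
  ultimately have 1: "a1 = b1" using s by linarith
  have 2: "a2 + a3 = b2 + b3" "a2\<^sup>2 + a3\<^sup>2 = b2\<^sup>2 + b3\<^sup>2" using p 1 by simp_all
  have "2 * ((a2 - b2) * (a2 - b3)) = 0" using 2 by algebra
  then have "a2 = b2 \<or> a2 = b3" by auto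
  then show ?thesis using 1 2(1) s by auto
qed

lemma quadratic_max_condition:
  fixes d e :: real
  assumes "\<And>t. t * e \<le> t\<^sup>2 * d"
  shows "e = 0"
proof -
  \<comment> \<open>Testing at t = e / k with k > d makes the linear term exceed the quadratic one
    unless e = 0.\<close>
  define k where "k = \<bar>d\<bar> + 1"
  have k: "k > 0" "d < k" by (auto simp: k_def)
  have "e / k * e \<le> (e / k)\<^sup>2 * d" by (rule assms)
  then have "e\<^sup>2 * k \<le> e\<^sup>2 * d" using k(1) by (simp add: field_simps power2_eq_square)
  then show ?thesis using k(2) by (smt (verit) mult_left_mono mult_left_le_imp_le zero_less_power2)
qed

text \<open>This is first-order stationarity of C d + S e at the identity rotation. The rational
  parametrisation of the circle turns it into \<open>quadratic_max_condition\<close>.\<close>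

lemma rotation_max_condition:
  fixes d e :: real
  assumes "\<And>C S. C\<^sup>2 + S\<^sup>2 = 1 \<Longrightarrow> (C - 1) * d + S * e \<le> 0"
  shows "e = 0"
proof (rule quadratic_max_condition[of e d])
  fix t :: real
  have t: "1 + t\<^sup>2 > 0" by (simp add: add_pos_nonneg)
  have "((1 - t\<^sup>2) / (1 + t\<^sup>2))\<^sup>2 + (2 * t / (1 + t\<^sup>2))\<^sup>2 = ((1 - t\<^sup>2)\<^sup>2 + (2 * t)\<^sup>2) / (1 + t\<^sup>2)\<^sup>2"
    by (simp add: power_divide add_divide_distrib)
  also have "(1 - t\<^sup>2)\<^sup>2 + (2 * t)\<^sup>2 = (1 + t\<^sup>2)\<^sup>2" by (simp add: power2_eq_square algebra_simps)
  finally have "((1 - t\<^sup>2) / (1 + t\<^sup>2))\<^sup>2 + (2 * t / (1 + t\<^sup>2))\<^sup>2 = 1" using t by simp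
  from assms[OF this] have "((1 - t\<^sup>2) / (1 + t\<^sup>2) - 1) * d + 2 * t / (1 + t\<^sup>2) * e \<le> 0" .
  also have "((1 - t\<^sup>2) / (1 + t\<^sup>2) - 1) * d + 2 * t / (1 + t\<^sup>2) * e = 2 * (t * e - t\<^sup>2 * d) / (1 + t\<^sup>2)"
  proof -
    define u where "u = 1 + t\<^sup>2"
    have u: "u \<noteq> 0" and t2: "t\<^sup>2 = u - 1" using t by (simp_all add: u_def)
    show ?thesis unfolding u_def[symmetric] unfolding t2 using u by (simp add: field_simps)
  qed
  finally show "t * e \<le> t\<^sup>2 * d" using t by (simp add: divide_le_0_iff)
qed

text \<open>The same for a quadratic form in C and S: the parameter t = S / C gives stationarity at
  the identity, and the quarter turn gives the sign of \<open>d\<close>.\<close>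

lemma double_rotation_max_condition:
  fixes d e :: real
  assumes *: "\<And>C S. C\<^sup>2 + S\<^sup>2 = 1 \<Longrightarrow> S\<^sup>2 * d - 2 * C * S * e \<le> 0"
  shows "e = 0" "d \<le> 0"
proof -
  show "d \<le> 0" using *[of 0 1] by simp
  have "- 2 * e = 0"
  proof (rule quadratic_max_condition[of _ "- d"])
    fix t :: real
    have t: "1 + t\<^sup>2 > 0" by (simp add: add_pos_nonneg)
    define r where "r = sqrt (1 + t\<^sup>2)"
    have r: "r > 0" "r\<^sup>2 = 1 + t\<^sup>2" using t by (simp_all add: r_def)
    have "(1 / r)\<^sup>2 + (t / r)\<^sup>2 = 1"
      using r t by (simp add: power_divide add_divide_distrib[symmetric])
    from *[OF this] have "(t\<^sup>2 * d - 2 * t * e) / r\<^sup>2 \<le> 0"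
      using r(1) by (simp add: power_divide diff_divide_distrib power2_eq_square mult.assoc)
    then have "t\<^sup>2 * d - 2 * t * e \<le> 0" using r t by (simp add: divide_le_0_iff)
    then show "t * (- 2 * e) \<le> t\<^sup>2 * - d" by simp
  qed
  then show "e = 0" by simp
qed

section \<open>Diagonalisation\<close>

lemma compact_frames: "compact {f. frame (f :: 'a::euclidean_space frame)}"
proof -
  have "{f. frame (f :: 'a frame)} = (sphere 0 1 \<times> sphere 0 1 \<times> sphere 0 1 \<times> sphere 0 1) \<inter>
     {f. fst f \<bullet> fst (snd f) = 0 \<and> fst f \<bullet> fst (snd (snd f)) = 0 \<and> fst f \<bullet> snd (snd (snd f)) = 0 \<and>
         fst (snd f) \<bullet> fst (snd (snd f)) = 0 \<and> fst (snd f) \<bullet> snd (snd (snd f)) = 0 \<and>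
         fst (snd (snd f)) \<bullet> snd (snd (snd f)) = 0}"
    by (auto simp: frame_def norm_eq_1)
  moreover have "closed {f :: 'a frame. fst f \<bullet> fst (snd f) = 0 \<and> fst f \<bullet> fst (snd (snd f)) = 0 \<and> fst f \<bullet> snd (snd (snd f)) = 0 \<and>
         fst (snd f) \<bullet> fst (snd (snd f)) = 0 \<and> fst (snd f) \<bullet> snd (snd (snd f)) = 0 \<and>
         fst (snd (snd f)) \<bullet> snd (snd (snd f)) = 0}"
    by (intro closed_Collect_conj closed_Collect_eq continuous_intros)
  ultimately show ?thesis by (simp add: compact_Int_closed compact_Times)
qed

lemma continuous_on_block:
  fixes R :: "'a::euclidean_space \<Rightarrow> 'a \<Rightarrow> 'a \<Rightarrow> 'a \<Rightarrow> real"
  assumes "algebraic_curvature_tensor R"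
  shows "continuous_on S (\<lambda>f. block s t R f i j)"
proof -
  have "\<forall>i j. continuous_on S (\<lambda>f. block s t R f i j)"
    unfolding forall_3 block_def bivec_def case_prod_unfold vector_3
    by (intro conjI continuous_intros continuous_on_curvature[OF assms])
  then show ?thesis by blast
qed

lemma frame_exists:
  assumes "DIM('a::euclidean_space) = 4"
  shows "\<exists>f :: 'a frame. frame f"
proof -
  obtain xs :: "'a list" where xs: "set xs = Basis" "distinct xs"
    using finite_distinct_list finite_Basis by blast
  then have "length xs = 4" using assms distinct_card by metis
  then obtain f0 f1 f2 f3 where "xs = [f0, f1, f2, f3]"
    by (auto simp: numeral_eq_Suc length_Suc_conv)
  then have B: "Basis = {f0, f1, f2, f3}" "distinct [f0, f1, f2, f3]" using xs by auto
  then have "f0 \<in> (Basis :: 'a set)" "f1 \<in> (Basis :: 'a set)" "f2 \<in> (Basis :: 'a set)" "f3 \<in> (Basis :: 'a set)"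
    by blast+
  then have "frame (f0, f1, f2, f3)"
    using B(2) by (simp add: frame_def inner_Basis)
  then show ?thesis by blast
qed

text \<open>The weights \<open>c\<close> will be pairwise distinct: then stationarity under rotations of the
  self-dual and of the anti-self-dual bivectors forces the corresponding blocks to be diagonal.\<close>

definition dual_energy :: "('a::euclidean_space \<Rightarrow> 'a \<Rightarrow> 'a \<Rightarrow> 'a \<Rightarrow> real) \<Rightarrow> real^3 \<Rightarrow> 'a frame \<Rightarrow> real" where
  "dual_energy R c f = (\<Sum>i\<in>UNIV. c$i * (block 1 1 R f i i + block (-1) (-1) R f i i))"

definition dual_maximal :: "('a::euclidean_space \<Rightarrow> 'a \<Rightarrow> 'a \<Rightarrow> 'a \<Rightarrow> real) \<Rightarrow> real^3 \<Rightarrow> 'a frame \<Rightarrow> bool" where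
  "dual_maximal R c f \<longleftrightarrow> frame f \<and> (\<forall>f'. frame f' \<longrightarrow> dual_energy R c f' \<le> dual_energy R c f)"

context
  fixes R :: "'a::euclidean_space \<Rightarrow> 'a \<Rightarrow> 'a \<Rightarrow> 'a \<Rightarrow> real"
  assumes ac: "algebraic_curvature_tensor R" and dim: "DIM('a) = 4"
begin

lemma dual_maximal_exists: "\<exists>f. dual_maximal R c f"
proof -
  have "continuous_on {f. frame f} (dual_energy R c)"
    unfolding dual_energy_def by (intro continuous_intros continuous_on_block[OF ac])
  then show ?thesis
    using continuous_attains_sup[OF compact_frames] frame_exists[OF dim]
    unfolding dual_maximal_def by blast
qed

lemma dual_maximal_cycle:
  assumes "dual_maximal R c f"
  shows "dual_maximal R (vector [c$2, c$3, c$1]) (cycle_frame f)"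
proof -
  have e: "dual_energy R (vector [c$2, c$3, c$1]) (cycle_frame g) = dual_energy R c g" for g
    unfolding dual_energy_def block_cycle[OF ac] by (simp add: sum_3)
  have "g = cycle_frame (cycle_frame (cycle_frame g))" for g :: "'a frame" by (cases g) simp
  then show ?thesis
    using assms frame_cycle unfolding dual_maximal_def by (metis e)
qed

lemma dual_maximal_flip:
  assumes "dual_maximal R c f"
  shows "dual_maximal R c (flip_frame f)"
proof -
  have e: "dual_energy R c (flip_frame g) = dual_energy R c g" for g
    unfolding dual_energy_def block_flip[OF ac] by (simp add: add.commute)
  then show ?thesis
    using assms frame_flip unfolding dual_maximal_def by metis
qed

text \<open>A rotation about the first axis changes the diagonal entries 2 2 and 3 3 by opposite
  amounts, hence the energy by c2 - c3 times the first change. Stationarity yields the off-diagonal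
  entry, comparison with the quarter turn yields the order.\<close>

lemma dual_maximal_anti:
  assumes m: "dual_maximal R c f"
  shows "(c$2 - c$3) * block (-1) (-1) R f 2 3 = 0"
    and "(c$2 - c$3) * (block (-1) (-1) R f 2 2 - block (-1) (-1) R f 3 3) \<ge> 0"
proof -
  let ?b = "block (-1) (-1) R f"
  have fr: "frame f" using m unfolding dual_maximal_def by blast
  have s: "?b 3 2 = ?b 2 3" by (rule block_transpose[OF ac])
  have *: "S\<^sup>2 * ((c$2 - c$3) * (?b 3 3 - ?b 2 2)) - 2 * C * S * ((c$2 - c$3) * ?b 2 3) \<le> 0"
    if CS: "C\<^sup>2 + S\<^sup>2 = 1" for C S
  proof -
    obtain f' where f': "frame f'" "\<And>i j. block 1 1 R f' i j = block 1 1 R f i j"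
      "\<And>i j. block (-1) (-1) R f' i j = rotate_23 C S (\<chi> i. rotate_23 C S (\<chi> j. ?b i j) $ j) $ i"
      using block_rotate[OF ac fr CS] by metis
    have C: "C\<^sup>2 = 1 - S\<^sup>2" using CS by simp
    have b2: "block (-1) (-1) R f' 2 2 = ?b 2 2 + (S\<^sup>2 * (?b 3 3 - ?b 2 2) - 2 * C * S * ?b 2 3)"
      "block (-1) (-1) R f' 3 3 = ?b 3 3 - (S\<^sup>2 * (?b 3 3 - ?b 2 2) - 2 * C * S * ?b 2 3)"
    proof -
      have "block (-1) (-1) R f' 2 2 = C\<^sup>2 * ?b 2 2 - 2 * C * S * ?b 2 3 + S\<^sup>2 * ?b 3 3"
        "block (-1) (-1) R f' 3 3 = S\<^sup>2 * ?b 2 2 + 2 * C * S * ?b 2 3 + C\<^sup>2 * ?b 3 3"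
        unfolding f'(3) rotate_23_def by (simp_all add: s algebra_simps power2_eq_square)
      then show "block (-1) (-1) R f' 2 2 = ?b 2 2 + (S\<^sup>2 * (?b 3 3 - ?b 2 2) - 2 * C * S * ?b 2 3)"
        "block (-1) (-1) R f' 3 3 = ?b 3 3 - (S\<^sup>2 * (?b 3 3 - ?b 2 2) - 2 * C * S * ?b 2 3)"
        by (simp_all add: C algebra_simps)
    qed
    have b1: "block (-1) (-1) R f' 1 1 = ?b 1 1" unfolding f'(3) rotate_23_def by simp
    have "dual_energy R c f' \<le> dual_energy R c f" using m f'(1) unfolding dual_maximal_def by blast
    then show ?thesis
      unfolding dual_energy_def sum_3 f'(2) b1 b2 by (simp add: algebra_simps)
  qed
  show "(c$2 - c$3) * ?b 2 3 = 0" by (rule double_rotation_max_condition(1)[OF *])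
  show "(c$2 - c$3) * (?b 2 2 - ?b 3 3) \<ge> 0"
    using double_rotation_max_condition(2)[OF *] by (simp add: algebra_simps)
qed

text \<open>Cycling treats the other two axes and flipping the self-dual block. The decreasing
  weights sort both diagonals, which makes the two spectra comparable.\<close>

lemma dual_maximal_diagonal:
  assumes m: "dual_maximal R (vector [3, 2, 1]) f"
  obtains a b z where "has_blocks R f a b z" "a$1 \<ge> a$2" "a$2 \<ge> a$3" "b$1 \<ge> b$2" "b$2 \<ge> b$3"
proof -
  note m' = dual_maximal_cycle[OF m]
  note m'' = dual_maximal_cycle[OF m']
  note n = dual_maximal_flip[OF m] and n' = dual_maximal_flip[OF m'] and n'' = dual_maximal_flip[OF m'']
  note x = m[THEN dual_maximal_anti(1)] m'[THEN dual_maximal_anti(1)] m''[THEN dual_maximal_anti(1)]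
     m[THEN dual_maximal_anti(2)] m'[THEN dual_maximal_anti(2)] m''[THEN dual_maximal_anti(2)]
     n[THEN dual_maximal_anti(1)] n'[THEN dual_maximal_anti(1)] n''[THEN dual_maximal_anti(1)]
     n[THEN dual_maximal_anti(2)] n'[THEN dual_maximal_anti(2)] n''[THEN dual_maximal_anti(2)]
  note x' = x[unfolded block_flip[OF ac] block_cycle[OF ac], simplified]
  define a :: "real^3" where "a = (\<chi> i. block 1 1 R f i i)"
  define b :: "real^3" where "b = (\<chi> i. block (-1) (-1) R f i i)"
  define z :: "real^3^3" where "z = (\<chi> i j. block 1 (-1) R f i j)"
  have t: "block s s R f 2 1 = block s s R f 1 2" "block s s R f 3 1 = block s s R f 1 3"
    "block s s R f 3 2 = block s s R f 2 3" for s
    by (rule block_transpose[OF ac])+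
  have "has_blocks R f a b z"
    using m x' unfolding has_blocks_def dual_maximal_def forall_3 a_def b_def z_def by (simp add: t)
  moreover have "a$1 \<ge> a$2" "a$2 \<ge> a$3" "b$1 \<ge> b$2" "b$2 \<ge> b$3"
    using x' by (simp_all add: a_def b_def)
  ultimately show ?thesis using that by blast
qed

end

text \<open>Rotating the self-dual and the anti-self-dual bivectors independently inside a common eigenspace
  gives \<open>c\<^sub>i Z\<^sub>i\<^sub>j = c\<^sub>j Z\<^sub>j\<^sub>i\<close> and \<open>c\<^sub>i Z\<^sub>j\<^sub>i = c\<^sub>j Z\<^sub>i\<^sub>j\<close> at a maximum, hence \<open>Z\<^sub>i\<^sub>j = 0\<close> for distinct positive
  weights.\<close>

definition mixed_energy :: "('a::euclidean_space \<Rightarrow> 'a \<Rightarrow> 'a \<Rightarrow> 'a \<Rightarrow> real) \<Rightarrow> real^3 \<Rightarrow> 'a frame \<Rightarrow> real" where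
  "mixed_energy R c f = (\<Sum>i\<in>UNIV. c$i * block 1 (-1) R f i i)"

definition mixed_maximal :: "('a::euclidean_space \<Rightarrow> 'a \<Rightarrow> 'a \<Rightarrow> 'a \<Rightarrow> real) \<Rightarrow> real^3 \<Rightarrow> real^3 \<Rightarrow> 'a frame \<Rightarrow> bool" where
  "mixed_maximal R c w f \<longleftrightarrow> (\<exists>z. has_blocks R f w w z) \<and>
     (\<forall>f' z'. has_blocks R f' w w z' \<longrightarrow> mixed_energy R c f' \<le> mixed_energy R c f)"

context
  fixes R :: "'a::euclidean_space \<Rightarrow> 'a \<Rightarrow> 'a \<Rightarrow> 'a \<Rightarrow> real"
  assumes ac: "algebraic_curvature_tensor R" and dim: "DIM('a) = 4"
    and int: "\<forall>x. norm x = 1 \<longrightarrow> integrability_conditions R x"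
begin

lemma has_blocks_iff:
  "(\<exists>z. has_blocks R f a b z) \<longleftrightarrow> frame f \<and>
     (\<forall>i j. block 1 1 R f i j = (if i = j then a $ i else 0)) \<and>
     (\<forall>i j. block (-1) (-1) R f i j = (if i = j then b $ i else 0))"
proof -
  have "\<exists>z :: real^3^3. \<forall>i j. block 1 (-1) R f i j = z $ i $ j"
    by (rule exI[of _ "\<chi> i j. block 1 (-1) R f i j"]) simp
  then show ?thesis unfolding has_blocks_def by blast
qed

lemma mixed_maximal_exists:
  assumes "has_blocks R f w w z"
  shows "\<exists>f. mixed_maximal R c w f"
proof -
  let ?S = "{f. \<exists>z. has_blocks R f w w z}"
  \<comment> \<open>The frames in which both blocks equal the diagonal matrix of \<open>w\<close>
    form a closed subset of the compact set of all frames.\<close>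
  have S: "?S = {f. frame f} \<inter> {f. (\<forall>i j. block 1 1 R f i j = (if i = j then w $ i else 0)) \<and>
     (\<forall>i j. block (-1) (-1) R f i j = (if i = j then w $ i else 0))}"
    unfolding has_blocks_iff by blast
  have "closed {f. (\<forall>i j. block 1 1 R f i j = (if i = j then w $ i else 0)) \<and>
     (\<forall>i j. block (-1) (-1) R f i j = (if i = j then w $ i else 0))}"
    by (intro closed_Collect_conj closed_Collect_all closed_Collect_eq continuous_on_block[OF ac] continuous_on_const)
  from compact_Int_closed[OF compact_frames this] have "compact ?S" unfolding S .
  moreover have "continuous_on ?S (mixed_energy R c)"
    unfolding mixed_energy_def by (intro continuous_intros continuous_on_block[OF ac])
  ultimately show ?thesis
    using continuous_attains_sup[of ?S "mixed_energy R c"] assms unfolding mixed_maximal_def by blast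
qed

lemma mixed_maximal_cycle:
  assumes "mixed_maximal R c w f"
  shows "mixed_maximal R (vector [c$2, c$3, c$1]) (vector [w$2, w$3, w$1]) (cycle_frame f)"
proof -
  have e: "mixed_energy R (vector [c$2, c$3, c$1]) (cycle_frame g) = mixed_energy R c g" for g
    unfolding mixed_energy_def block_cycle[OF ac] by (simp add: sum_3)
  have c3: "g = cycle_frame (cycle_frame (cycle_frame g))" for g :: "'a frame" by (cases g) simp
  show ?thesis
    unfolding mixed_maximal_def
  proof (intro conjI allI impI)
    show "\<exists>z. has_blocks R (cycle_frame f) (vector [w$2, w$3, w$1]) (vector [w$2, w$3, w$1]) z"
      using assms has_blocks_cycle[OF ac] unfolding mixed_maximal_def by blast
    fix f' z' assume "has_blocks R f' (vector [w$2, w$3, w$1]) (vector [w$2, w$3, w$1]) z'"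
    from has_blocks_cycle[OF ac has_blocks_cycle[OF ac this]]
    have "\<exists>z. has_blocks R (cycle_frame (cycle_frame f')) (vector [w$1, w$2, w$3]) (vector [w$1, w$2, w$3]) z"
      by auto
    moreover have "vector [w$1, w$2, w$3] = w" by (simp add: vec_eq_iff forall_3)
    ultimately have "mixed_energy R c (cycle_frame (cycle_frame f')) \<le> mixed_energy R c f"
      using assms unfolding mixed_maximal_def by metis
    then show "mixed_energy R (vector [c$2, c$3, c$1]) f' \<le> mixed_energy R (vector [c$2, c$3, c$1]) (cycle_frame f)"
      by (subst c3) (simp only: e)
  qed
qed

text \<open>Flipping exchanges the two diagonal blocks, which are equal here, and transposes the
  mixed block, whose diagonal determines the energy.\<close>

lemma mixed_maximal_flip:
  assumes "mixed_maximal R c w f"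
  shows "mixed_maximal R c w (flip_frame f)"
proof -
  have e: "mixed_energy R c (flip_frame g) = mixed_energy R c g" for g
    unfolding mixed_energy_def block_flip[OF ac] using block_transpose[OF ac, of 1 "-1" g] by simp
  have c3: "g = flip_frame (flip_frame g)" for g :: "'a frame" by (cases g) simp
  show ?thesis
    using assms has_blocks_flip[OF ac] unfolding mixed_maximal_def by (metis e c3)
qed

text \<open>As w2 = w3, every rotation about the first axis preserves the diagonal blocks, so it
  leads to a competitor. The energy along these rotations is a constant plus a linear form in C and
  S.\<close>

lemma mixed_maximal_stationary:
  assumes m: "mixed_maximal R c w f" and w: "w$2 = w$3"
  shows "c$3 * block 1 (-1) R f 3 2 = c$2 * block 1 (-1) R f 2 3"
proof -
  obtain z where h: "has_blocks R f w w z" using m unfolding mixed_maximal_def by blast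
  have z: "block 1 (-1) R f i j = z$i$j" for i j using h unfolding has_blocks_def by blast
  have "c$3 * z$3$2 - c$2 * z$2$3 = 0"
  proof (rule rotation_max_condition[of "c$2 * z$2$2 + c$3 * z$3$3"])
    fix C S :: real assume CS: "C\<^sup>2 + S\<^sup>2 = 1"
    have "C * S * (w$2 - w$3) = 0" using w by simp
    from has_blocks_rotate[OF ac h CS this] obtain f' where
      "has_blocks R f' w (vector [w$1, C\<^sup>2 * w$2 + S\<^sup>2 * w$3, S\<^sup>2 * w$2 + C\<^sup>2 * w$3]) (\<chi> i. rotate_23 C S (z $ i))" ..
    moreover have "vector [w$1, C\<^sup>2 * w$2 + S\<^sup>2 * w$3, S\<^sup>2 * w$2 + C\<^sup>2 * w$3] = w"
      using CS w by (simp add: vec_eq_iff forall_3 distrib_right[symmetric] add.commute)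
    ultimately have h': "has_blocks R f' w w (\<chi> i. rotate_23 C S (z $ i))" by simp
    then have "mixed_energy R c f' \<le> mixed_energy R c f" using m unfolding mixed_maximal_def by blast
    moreover have "block 1 (-1) R f' i j = rotate_23 C S (z $ i) $ j" for i j
      using h' unfolding has_blocks_def by simp
    ultimately show "(C - 1) * (c$2 * z$2$2 + c$3 * z$3$3) + S * (c$3 * z$3$2 - c$2 * z$2$3) \<le> 0"
      unfolding mixed_energy_def by (simp add: sum_3 z rotate_23_def algebra_simps)
  qed
  then show ?thesis by (simp add: z)
qed

lemma mixed_maximal_diagonal_23:
  assumes m: "mixed_maximal R c w f" and c: "c$2 > 0" "c$3 > 0" "c$2 \<noteq> c$3"
  shows "block 1 (-1) R f 2 3 = 0 \<and> block 1 (-1) R f 3 2 = 0"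
proof -
  obtain z where h: "has_blocks R f w w z" using m unfolding mixed_maximal_def by blast
  have z: "block 1 (-1) R f i j = z$i$j" for i j using h unfolding has_blocks_def by blast
  show ?thesis
  proof (cases "w$2 = w$3")
    case False
    then show ?thesis
      using intertwining[OF ac dim int h, of 2 3] intertwining[OF ac dim int h, of 3 2] by (simp add: z)
  next
    case True
    have 1: "c$3 * z$3$2 = c$2 * z$2$3"
      using mixed_maximal_stationary[OF m True] by (simp add: z)
    have 2: "c$3 * z$2$3 = c$2 * z$3$2"
      using mixed_maximal_stationary[OF mixed_maximal_flip[OF m] True]
        block_transpose[OF ac, of "-1" 1] by (simp add: z block_flip[OF ac])
    have "(c$2 + c$3) * (c$2 - c$3) * z$2$3 = 0" using 1 2 by algebra
    then have "z$2$3 = 0" using c by simp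
    then show ?thesis using 1 c by (simp add: z)
  qed
qed

lemma diagonal_blocks_exist:
  obtains f w z where "has_blocks R f w w z" "\<And>i j. i \<noteq> j \<Longrightarrow> z$i$j = 0"
proof -
  obtain f0 where "dual_maximal R (vector [3, 2, 1]) f0" using dual_maximal_exists[OF ac dim] by blast
  then obtain a b z where h: "has_blocks R f0 a b z"
    and s: "a$1 \<ge> a$2" "a$2 \<ge> a$3" "b$1 \<ge> b$2" "b$2 \<ge> b$3"
    by (rule dual_maximal_diagonal[OF ac dim])
  have "a = b"
    using sorted_triples_eq[OF s has_blocks_trace_conditions(1)[OF ac dim int h]
        diagonal_condition(1)[OF ac dim int h] power_sums[OF ac dim int h]]
    by (simp add: vec_eq_iff forall_3)
  then obtain f where m: "mixed_maximal R (vector [3, 2, 1]) a f" using mixed_maximal_exists h by blast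
  note m' = mixed_maximal_cycle[OF m]
  note m'' = mixed_maximal_cycle[OF m']
  have z: "\<forall>i j. i \<noteq> j \<longrightarrow> block 1 (-1) R f i j = 0"
    using m[THEN mixed_maximal_diagonal_23] m'[THEN mixed_maximal_diagonal_23]
      m''[THEN mixed_maximal_diagonal_23] unfolding block_cycle[OF ac] by (simp add: forall_3)
  obtain z where "has_blocks R f a a z" using m unfolding mixed_maximal_def by blast
  moreover from this have "z$i$j = 0" if "i \<noteq> j" for i j
    using z that unfolding has_blocks_def by metis
  ultimately show ?thesis using that by blast
qed

lemma diagonal_frame_exists:
  obtains f0 f1 f2 f3 where "frame (f0, f1, f2, f3)" "diagonal_wrt {f0, f1, f2, f3} R"
proof -
  obtain f0 f1 f2 f3 w z where h: "has_blocks R (f0, f1, f2, f3) w w z"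
    and z: "\<And>i j. i \<noteq> j \<Longrightarrow> z$i$j = 0"
    by (rule diagonal_blocks_exist) (metis surj_pair)
  let ?f = "(f0, f1, f2, f3)"
  have f: "frame ?f" using h unfolding has_blocks_def by blast
  note D = algebraic_curvature_tensorD[OF ac]
  have b: "block 1 1 R ?f i j = (if i = j then w$i else 0)"
    "block (-1) (-1) R ?f i j = (if i = j then w$i else 0)"
    "block 1 (-1) R ?f i j = (if i = j then z$i$i else 0)"
    "block (-1) 1 R ?f i j = (if i = j then z$i$i else 0)" for i j
    using h z block_transpose[OF ac, of "-1" 1 ?f i j] unfolding has_blocks_def by auto
  \<comment> \<open>These combinations undo the splitting into self-dual and anti-self-dual parts:
    two planes through f0, one such plane and one dual plane, and two dual planes.\<close>
  have "\<forall>i j. radial_block R ?f i j = (if i = j then (w$i + z$i$i) / 2 else 0)"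
    "\<forall>i j. dual_radial_block R ?f i j = 0"
    "\<forall>i j. block 1 1 R ?f i j - block 1 (-1) R ?f i j - block (-1) 1 R ?f i j + block (-1) (-1) R ?f i j
       = (if i = j then 2 * w$i - 2 * z$i$i else 0)"
    unfolding radial_block_def dual_radial_block_def b by simp_all
  note e = this[unfolded forall_3 radial_block_def dual_radial_block_def block_def bivec_def, simplified]
  have v: "R a b c d = 0 \<and> R b a c d = 0 \<and> R a b d c = 0 \<and> R b a d c = 0 \<and>
      R c d a b = 0 \<and> R d c a b = 0 \<and> R c d b a = 0 \<and> R d c b a = 0"
    if "R a b c d = 0" for a b c d
    using that D(5)[of a b c d] D(6)[of a b c d] D(5)[of a b d c] D(7)[of a b c d] D(7)[of b a c d]
      D(7)[of a b d c] D(7)[of b a d c] by simp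
  note z = curvature_repeated[OF ac]
  \<comment> \<open>One component for each of the fifteen pairs of distinct coordinate planes;
    \<open>v\<close> supplies the others by the symmetries of \<open>R\<close>.\<close>
  have zeros: "R f0 f1 f0 f2 = 0" "R f0 f1 f0 f3 = 0" "R f0 f2 f0 f3 = 0"
    "R f0 f1 f2 f3 = 0" "R f0 f1 f3 f1 = 0" "R f0 f1 f1 f2 = 0"
    "R f0 f2 f2 f3 = 0" "R f0 f2 f3 f1 = 0" "R f0 f2 f1 f2 = 0"
    "R f0 f3 f2 f3 = 0" "R f0 f3 f3 f1 = 0" "R f0 f3 f1 f2 = 0"
    "R f2 f3 f3 f1 = 0" "R f2 f3 f1 f2 = 0" "R f3 f1 f1 f2 = 0"
    using e by simp_all
  have "diagonal_wrt {f0, f1, f2, f3} R"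
    unfolding diagonal_wrt_def by (simp add: zeros[THEN v] z insert_commute)
  then show ?thesis using that f by blast
qed

end

section \<open>Orthonormal bases and isometries\<close>

lemma orthonormal_basis_of_frame:
  fixes f0 :: "'a::euclidean_space"
  assumes "DIM('a) = 4" "frame (f0, f1, f2, f3)"
  shows "orthonormal_basis {f0, f1, f2, f3}"
proof -
  note f = assms(2)[unfolded frame_def, simplified]
  have "v \<in> span {f0, f1, f2, f3}" for v
    by (subst frame_expansion[OF assms, of v]) (intro span_add span_scale span_base; simp)
  then show ?thesis
    using f unfolding orthonormal_basis_def
    by (auto simp: pairwise_def orthogonal_def inner_commute norm_eq_1)
qed

lemma frame_of_orthonormal_basis:
  fixes B :: "'a::euclidean_space set"
  assumes dim: "DIM('a) = 4" and B: "orthonormal_basis B"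
  obtains b0 b1 b2 b3 where "B = {b0, b1, b2, b3}" "frame (b0, b1, b2, b3)"
proof -
  have p: "pairwise orthogonal B" "\<forall>b\<in>B. norm b = 1" "span B = UNIV"
    using B unfolding orthonormal_basis_def by blast+
  have "independent B"
    by (rule pairwise_orthogonal_independent) (use p in auto)
  then have "card B = 4" "finite B"
    using dim_eq_card[of B UNIV] p(3) dim independent_bound by (auto simp: dim_UNIV)
  then obtain xs where xs: "set xs = B" "distinct xs" "length xs = 4"
    using finite_distinct_list distinct_card by metis
  then obtain b0 b1 b2 b3 where x: "xs = [b0, b1, b2, b3]"
    by (auto simp: numeral_eq_Suc length_Suc_conv)
  then have eq: "B = {b0, b1, b2, b3}" using xs by auto
  have "frame (b0, b1, b2, b3)"
    using p(1,2) xs(2) unfolding eq x frame_def pairwise_def orthogonal_def by (simp add: norm_eq_1)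
  then show ?thesis using that eq by blast
qed

lemma isometry_between_frames:
  fixes f0 :: "'a::euclidean_space"
  assumes dim: "DIM('a) = 4" and f: "frame (f0, f1, f2, f3)" and b: "frame (b0, b1, b2, b3)"
  obtains U where "orthogonal_transformation U" "U f0 = b0" "U f1 = b1" "U f2 = b2" "U f3 = b3"
proof -
  note f' = f[unfolded frame_def, simplified] and b' = b[unfolded frame_def, simplified]
  note fc = inner_commute[of f1 f0] inner_commute[of f2 f0] inner_commute[of f3 f0]
    inner_commute[of f2 f1] inner_commute[of f3 f1] inner_commute[of f3 f2]
  note bc = inner_commute[of b1 b0] inner_commute[of b2 b0] inner_commute[of b3 b0]
    inner_commute[of b2 b1] inner_commute[of b3 b1] inner_commute[of b3 b2]
  define U where "U v = (v \<bullet> f0) *\<^sub>R b0 + (v \<bullet> f1) *\<^sub>R b1 + (v \<bullet> f2) *\<^sub>R b2 + (v \<bullet> f3) *\<^sub>R b3" for v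
  have "linear U"
    by (intro linearI) (simp_all add: U_def inner_add_left algebra_simps)
  moreover have "U v \<bullet> U w = v \<bullet> w" for v w
  proof -
    have "U v \<bullet> U w = (v \<bullet> f0) * (w \<bullet> f0) + (v \<bullet> f1) * (w \<bullet> f1) + (v \<bullet> f2) * (w \<bullet> f2) + (v \<bullet> f3) * (w \<bullet> f3)"
      using b' bc by (simp add: U_def inner_add_left inner_add_right)
    also have "\<dots> = v \<bullet> w"
      by (subst (5) frame_expansion[OF dim f, of w]) (simp add: inner_add_right mult.commute)
    finally show ?thesis .
  qed
  ultimately have "orthogonal_transformation U" unfolding orthogonal_transformation_def by blast
  moreover have "U f0 = b0" "U f1 = b1" "U f2 = b2" "U f3 = b3"
    using f' fc by (simp_all add: U_def)
  ultimately show ?thesis using that by blast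
qed

lemma curvature_tensor_of_apply_isometry:
  fixes K :: "'a::euclidean_space \<Rightarrow> 'a \<Rightarrow> 'a \<Rightarrow> real"
  assumes R: "curvature_tensor_of R K" and U: "orthogonal_transformation U"
  shows "curvature_tensor_of (\<lambda>a b c d. R (inv U a) (inv U b) (inv U c) (inv U d)) (apply_isometry U K)"
proof -
  define g where "g = inv U"
  have g: "linear g" "g a \<bullet> g b = a \<bullet> b" "norm (g a) = norm a" for a b
    using orthogonal_transformation_inv[OF U] orthogonal_transformation_norm
    unfolding g_def[symmetric] orthogonal_transformation_def by metis+
  have ac: "algebraic_curvature_tensor R" and K: "\<And>x v w. x \<in> sphere 0 1 \<Longrightarrow> v \<in> tangent_space x \<Longrightarrow> w \<in> tangent_space x \<Longrightarrow> K x v w = R x v x w"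
    using R unfolding curvature_tensor_of_def by blast+
  note D = algebraic_curvature_tensorD[OF ac]
  have "algebraic_curvature_tensor (\<lambda>a b c d. R (g a) (g b) (g c) (g d))"
    unfolding algebraic_curvature_tensor_def
    by (intro conjI allI D(5-8) linear_compose[OF g(1) D(1), unfolded comp_def]
        linear_compose[OF g(1) D(2), unfolded comp_def] linear_compose[OF g(1) D(3), unfolded comp_def]
        linear_compose[OF g(1) D(4), unfolded comp_def])
  moreover have "apply_isometry U K x v w = R (g x) (g v) (g x) (g w)"
    if "x \<in> sphere 0 1" "v \<in> tangent_space x" "w \<in> tangent_space x" for x v w
    unfolding apply_isometry_def g_def[symmetric]
    by (rule K) (use that g in \<open>simp_all add: tangent_space_def\<close>)
  ultimately show ?thesis unfolding curvature_tensor_of_def g_def by blast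
qed

theorem theorem1p13:
  fixes K :: "'a::euclidean_space \<Rightarrow> 'a \<Rightarrow> 'a \<Rightarrow> real"
  assumes dim: "DIM('a) = 4"
    and killing: "killing_tensor K"
    and integrable: "integrable_tensor K"
  shows "(\<forall>B. orthonormal_basis B \<longrightarrow>
            (\<exists>U. orthogonal_transformation U \<and>
              (\<exists>R. curvature_tensor_of R (apply_isometry U K) \<and> diagonal_wrt B R)))
       \<and> (\<exists>R. curvature_tensor_of R K \<and>
            (\<exists>B. orthonormal_basis B \<and> diagonal_wrt B R))"
proof -
  obtain R where R: "curvature_tensor_of R K" using killing_tensor_has_curvature_tensor[OF killing] by blast
  then have ac: "algebraic_curvature_tensor R" unfolding curvature_tensor_of_def by blast
  obtain f0 f1 f2 f3 where f: "frame (f0, f1, f2, f3)" and diag: "diagonal_wrt {f0, f1, f2, f3} R"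
    using diagonal_frame_exists[OF ac dim integrability_conditions_on_sphere[OF dim R integrable]] by metis
  have "\<exists>U. orthogonal_transformation U \<and> (\<exists>R. curvature_tensor_of R (apply_isometry U K) \<and> diagonal_wrt B R)"
    if B: "orthonormal_basis B" for B
  proof -
    obtain b0 b1 b2 b3 where b: "B = {b0, b1, b2, b3}" "frame (b0, b1, b2, b3)"
      by (rule frame_of_orthonormal_basis[OF dim B])
    \<comment> \<open>As \<open>U\<close> carries the diagonalising frame to \<open>B\<close>, the
      components on \<open>B\<close> of the tensor pushed forward by \<open>U\<close> are those of
      \<open>R\<close> on that frame.\<close>
    obtain U where U: "orthogonal_transformation U" and Uf: "U f0 = b0" "U f1 = b1" "U f2 = b2" "U f3 = b3"
      by (rule isometry_between_frames[OF dim f b(2)])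
    have inj: "inj U" "inj (inv U)"
      using U orthogonal_transformation_inv[OF U] by (simp_all add: orthogonal_transformation_inj)
    have img: "inv U b \<in> {f0, f1, f2, f3}" if "b \<in> B" for b
      using that inj(1) Uf b(1) by (auto simp: inv_f_eq)
    have "diagonal_wrt B (\<lambda>a b c d. R (inv U a) (inv U b) (inv U c) (inv U d))"
      unfolding diagonal_wrt_def
    proof (intro ballI impI)
      fix i j k l assume m: "i \<in> B" "j \<in> B" "k \<in> B" "l \<in> B" and ne: "{i, j} \<noteq> {k, l}"
      have "inv U ` {i, j} \<noteq> inv U ` {k, l}" using ne by (simp only: inj_image_eq_iff[OF inj(2)] not_False_eq_True)
      then have ne': "{inv U i, inv U j} \<noteq> {inv U k, inv U l}" by simp
      show "R (inv U i) (inv U j) (inv U k) (inv U l) = 0"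
        by (rule diag[unfolded diagonal_wrt_def, rule_format, OF img[OF m(1)] img[OF m(2)] img[OF m(3)] img[OF m(4)] ne'])
    qed
    then show ?thesis using U curvature_tensor_of_apply_isometry[OF R U] by blast
  qed
  then show ?thesis using R diag orthonormal_basis_of_frame[OF dim f] by blast
qed

end
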